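(* Let $\mathcal{P}$ be any set of probability distributions on $\mathbb{N}=\{0,1,2,\ldots\}$, let $\mathcal{P}^\infty$ be the corresponding class of i.i.d. laws on loss sequences, and let $\Pi_0\in\mathbb{R}^+$. Then $\mathcal{P}^\infty$ is insurable (by an insurer with initial capital $\Pi_0$) if and only if no $p\in\mathcal{P}$ is deceptive.
   Context: Losses $X_1,X_2,\ldots\in\mathbb{N}$. $\mathcal{P}^\infty$ is the set of i.i.d. measures on $\mathbb{N}^\infty$ whose one-dimensional marginals form $\mathcal{P}$. $\mathbb{N}^*$ is the set of finite sequences over $\mathbb{N}$ (including the empty one), $x^n=x_1,\ldots,x_n$, and $\mathbb{R}^+$ is the set of nonnegative reals. An insurance scheme is a pair $(\tau,\Pi)$ with $\tau:\mathbb{N}^*\to\{0,1\}$ such that $\tau(x_1,\ldots,x_n)=1\Rightarrow\tau(x_1,\ldots,x_{n+1})=1$ for all $x^n$ and $p(\sup_n\tau(X^n)=1)=1$ for every $p\in\mathcal{P}^\infty$, and $\Pi:\mathbb{N}^*\to\mathbb{R}^+$ with $\Pi(x^n)=0$ whenever $\tau(x^n)=0$. The scheme goes bankrupt if $\Pi_0+\sum_{i=1}^n(\Pi(X^{i-1})-X_i)\mathbf{1}(\tau(X^{i-1})=1)<0$ for some $n\ge1$. $\mathcal{P}^\infty$ is insurable by an insurer with initial capital $\Pi_0$ if for every $\eta>0$ there is an insurance scheme $(\tau,\Pi)$ with $p((\tau,\Pi)\text{ goes bankrupt})<\eta$ for all $p\in\mathcal{P}^\infty$. For distributions $p,q$ on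 $\mathbb{N}$, $D(p\|q)=\sum_y p(y)\log_2\frac{p(y)}{q(y)}$ and $\mathrm{dist}(p,q):=D(p\|\frac{p+q}{2})+D(q\|\frac{p+q}{2})$. The (non-standard) cumulative distribution function $F_p:\mathbb{R}^+\cup\{\infty\}\to[0,1]$ is defined as the usual CDF $F_p(y)=p(\{0,\ldots,y\})$ at points $y$ of the support of $p$, by linear interpolation between consecutive support points, and $F_p(\infty)=1$; $F_p^{-1}:[0,1]\to\mathbb{R}^+\cup\{\infty\}$ is its inverse, with $F_p^{-1}(x)=0$ for $0\le x<F_p(0)$, $F_p^{-1}(1)=\infty$ if $p$ has infinite support, and otherwise $F_p^{-1}(1)$ the smallest natural number $y$ with $F_p(y)=1$. A distribution $p\in\mathcal{P}$ is deceptive if for every $\epsilon>0$ there exists $\delta>0$ such that for every real number $f$ there exists $q\in\mathcal{P}$ with $\mathrm{dist}(p,q)<\epsilon$ and $F_q^{-1}(1-\delta)>f$. *)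

theory Defs
  imports "HOL-Probability.Probability"
begin

(* Loss sequences X_1, X_2, ... are streams omega :: nat stream with X_i = omega !! (i-1);
   the prefix X^n is  stake n omega.
   The i.i.d. law p^infinity of p is  stream_space (measure_pmf p). *)

definition iid :: "nat pmf \<Rightarrow> nat stream measure" where
  "iid p = stream_space (measure_pmf p)"

definition insurance_scheme ::
  "nat pmf set \<Rightarrow> (nat list \<Rightarrow> bool) \<Rightarrow> (nat list \<Rightarrow> real) \<Rightarrow> bool" where
  "insurance_scheme P \<tau> Prem \<longleftrightarrow>
     (\<forall>xs x. \<tau> xs \<longrightarrow> \<tau> (xs @ [x])) \<and>
     (\<forall>p\<in>P. measure (iid p) {\<omega>. \<exists>n. \<tau> (stake n \<omega>)} = 1) \<and>
     (\<forall>xs. Prem xs \<ge> 0) \<and>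
     (\<forall>xs. \<not> \<tau> xs \<longrightarrow> Prem xs = 0)"

definition goes_bankrupt ::
  "real \<Rightarrow> (nat list \<Rightarrow> bool) \<Rightarrow> (nat list \<Rightarrow> real) \<Rightarrow> nat stream \<Rightarrow> bool" where
  "goes_bankrupt Pi0 \<tau> Prem \<omega> \<longleftrightarrow>
     (\<exists>n\<ge>1. Pi0 + (\<Sum>i<n. (Prem (stake i \<omega>) - real (\<omega> !! i))
                          * (if \<tau> (stake i \<omega>) then 1 else 0)) < 0)"

definition insurable :: "nat pmf set \<Rightarrow> real \<Rightarrow> bool" where
  "insurable P Pi0 \<longleftrightarrow>
     (\<forall>\<eta>>0. \<exists>\<tau> Prem. insurance_scheme P \<tau> Prem \<and>
        (\<forall>p\<in>P. measure (iid p) {\<omega>. goes_bankrupt Pi0 \<tau> Prem \<omega>} < \<eta>))"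

(* D(f || g) = sum_y f(y) log_2 (f(y)/g(y)), with 0 log 0 = 0 (automatic since 0 * _ = 0) *)
definition KL :: "(nat \<Rightarrow> real) \<Rightarrow> (nat \<Rightarrow> real) \<Rightarrow> real" where
  "KL f g = (\<Sum>y. f y * log 2 (f y / g y))"

definition distJS :: "nat pmf \<Rightarrow> nat pmf \<Rightarrow> real" where
  "distJS p q = (let m = (\<lambda>y. (pmf p y + pmf q y) / 2) in KL (pmf p) m + KL (pmf q) m)"

(* The paper's (non-standard) CDF on nonnegative reals: usual CDF at support points,
   linear interpolation between consecutive support points, 1 beyond the largest support
   point (if any), 0 below the smallest support point. *)
definition Fcdf :: "nat pmf \<Rightarrow> real \<Rightarrow> real" where
  "Fcdf q y =
    (if {s \<in> set_pmf q. real s \<le> y} = {} then 0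
     else let a = Max {s \<in> set_pmf q. real s \<le> y} in
       if {s \<in> set_pmf q. y < real s} = {} then 1
       else let b = (LEAST s. s \<in> set_pmf q \<and> y < real s) in
         measure_pmf.prob q {..a} + (y - real a) / (real b - real a) * pmf q b)"

definition Finv :: "nat pmf \<Rightarrow> real \<Rightarrow> real" where
  "Finv q x = Inf {y. 0 \<le> y \<and> x \<le> Fcdf q y}"

definition deceptive :: "nat pmf set \<Rightarrow> nat pmf \<Rightarrow> bool" where
  "deceptive P p \<longleftrightarrow>
     (\<forall>\<epsilon>>0. \<exists>\<delta>>0. \<forall>f::real. \<exists>q\<in>P. distJS p q < \<epsilon> \<and> Finv q (1 - \<delta>) > f)"

end

theory Submission
  imports Defs
begin

text \<open>Since the distance metrizes pointwise convergence of distributions, \<open>p\<close> is not deceptive iff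
  some neighbourhood of \<open>p\<close> in \<open>P\<close> is tight.

  If every point has a tight neighbourhood, countably many pointwise neighbourhoods cover \<open>P\<close>.
  Test them one after the other, each infinitely often, against the empirical frequencies, with
  sample sizes making all false answers together unlikely uniformly over all distributions. After
  the first passed test the true law almost certainly lies in a tight set, so that premiums which
  depend on time alone cover all later losses with high probability.

  Conversely, let \<open>p\<close> be deceptive. The insurer enters after finitely many losses with probability
  close to one under \<open>p\<close>, hence also under every close \<open>q\<close>. Let \<open>\<theta>\<close> be the mass that escapes to
  infinity near \<open>p\<close>, and choose \<open>M\<close> such that no close \<open>q\<close> has much more than \<open>\<theta>\<close> above \<open>M\<close>. Before
  the first loss above \<open>M\<close> only boundedly many premiums are possible, whereas that loss exceeds any
  prescribed \<open>f\<close> with probability bounded below for a suitable close \<open>q\<close>.\<close>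

section \<open>Independent losses: head, tail and cylinder events\<close>

lemma prob_space_iid: "prob_space (iid p)"
  unfolding iid_def by (rule prob_space.prob_space_stream_space[OF prob_space_measure_pmf])

lemma sets_iid [measurable_cong]: "sets (iid p) = sets (stream_space (count_space UNIV))"
  unfolding iid_def by (rule sets_stream_space_cong) simp

lemma space_iid [simp]: "space (iid p) = UNIV"
  by (simp add: iid_def space_stream_space streams_UNIV)

lemma measurable_stake_iid: "stake n \<in> measurable (iid p) (count_space UNIV)"
  by (simp add: measurable_cong_sets[OF sets_iid refl])

lemma prefix_fun_measurable: "(\<lambda>\<omega>. ennreal (g (stake n \<omega>))) \<in> borel_measurable (iid p)"
  by (rule measurable_compose[OF measurable_stake_iid]) simp

lemma prefix_event_sets: "{\<omega>. Q (stake n \<omega>)} \<in> sets (iid p)"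
proof -
  note measurable_stake_iid [measurable]
  have "Measurable.pred (iid p) (\<lambda>\<omega>. Q (stake n \<omega>))" by measurable
  then show ?thesis by (simp add: pred_def)
qed

lemma prefix_events_sets: "{\<omega>. \<exists>n. Q n (stake n \<omega>)} \<in> sets (iid p)"
proof -
  have "{\<omega>. \<exists>n. Q n (stake n \<omega>)} = (\<Union>n. {\<omega>. Q n (stake n \<omega>)})" by auto
  then show ?thesis using prefix_event_sets by auto
qed

lemma snth_event_sets: "{\<omega>. Q (\<omega> !! n)} \<in> sets (iid p)"
  using prefix_event_sets[of "\<lambda>xs. Q (xs ! n)" "Suc n"] by (simp add: stake_nth del: stake.simps)

lemma snth_events_sets: "{\<omega>. \<exists>k<K. Q k (\<omega> !! k) \<and> (\<forall>j<k. R j (\<omega> !! j))} \<in> sets (iid p)"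
proof -
  have "{\<omega>. \<exists>k<K. Q k (\<omega> !! k) \<and> (\<forall>j<k. R j (\<omega> !! j))} =
     {\<omega>. (\<lambda>xs. \<exists>k<K. Q k (xs ! k) \<and> (\<forall>j<k. R j (xs ! j))) (stake K \<omega>)}"
    by (auto simp: stake_nth)
  then show ?thesis using prefix_event_sets by simp
qed

lemma nn_integral_iid:
  assumes "f \<in> borel_measurable (iid p)"
  shows "(\<integral>\<^sup>+\<omega>. f \<omega> \<partial>iid p) = (\<integral>\<^sup>+x. (\<integral>\<^sup>+\<omega>. f (x ## \<omega>) \<partial>iid p) \<partial>measure_pmf p)"
  using assms unfolding iid_def by (rule prob_space.nn_integral_stream_space[OF prob_space_measure_pmf])

lemma head_tail_sets:
  assumes "B \<in> sets (iid p)"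
  shows "{\<omega>. shd \<omega> \<in> S \<and> stl \<omega> \<in> B} \<in> sets (iid p)"
proof -
  have [measurable]: "B \<in> sets (stream_space (measure_pmf p))" using assms by (simp add: iid_def)
  have [measurable]: "S \<in> sets (measure_pmf p)" by simp
  have "Measurable.pred (stream_space (measure_pmf p)) (\<lambda>\<omega>. shd \<omega> \<in> S \<and> stl \<omega> \<in> B)" by measurable
  then show ?thesis by (simp add: pred_def iid_def space_stream_space)
qed

lemma emeasure_iid_head_tail:
  assumes [measurable]: "B \<in> sets (iid p)"
  shows "emeasure (iid p) {\<omega>. shd \<omega> \<in> S \<and> stl \<omega> \<in> B} = emeasure (measure_pmf p) S * emeasure (iid p) B"
proof -
  have X: "{\<omega>. shd \<omega> \<in> S \<and> stl \<omega> \<in> B} \<in> sets (stream_space (measure_pmf p))"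
    using head_tail_sets[OF assms] by (simp add: iid_def)
  have "emeasure (iid p) {\<omega>. shd \<omega> \<in> S \<and> stl \<omega> \<in> B} =
      (\<integral>\<^sup>+t. emeasure (iid p) {\<omega>. t \<in> S \<and> \<omega> \<in> B} \<partial>measure_pmf p)"
    unfolding iid_def by (subst prob_space.emeasure_stream_space[OF prob_space_measure_pmf X])
      (simp add: space_stream_space streams_UNIV)
  also have "\<dots> = (\<integral>\<^sup>+t. emeasure (iid p) B * indicator S t \<partial>measure_pmf p)"
    by (intro nn_integral_cong) (auto split: split_indicator)
  also have "\<dots> = emeasure (measure_pmf p) S * emeasure (iid p) B"
    by (subst nn_integral_cmult_indicator) (auto simp: mult.commute)
  finally show ?thesis .
qed

lemma measure_iid_head_tail:
  assumes "B \<in> sets (iid p)"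
  shows "measure (iid p) {\<omega>. shd \<omega> \<in> S \<and> stl \<omega> \<in> B} = measure_pmf.prob p S * measure (iid p) B"
  using emeasure_iid_head_tail[OF assms, of S] by (simp add: measure_def enn2real_mult)

lemma measure_iid_tail:
  assumes "B \<in> sets (iid p)"
  shows "measure (iid p) {\<omega>. stl \<omega> \<in> B} = measure (iid p) B"
  using measure_iid_head_tail[OF assms, of UNIV] by (simp add: measure_pmf.prob_space[of p, simplified])

lemma measure_iid_snth: "measure (iid p) {\<omega>. \<omega> !! n \<in> S} = measure_pmf.prob p S"
proof (induction n)
  case 0
  have "UNIV \<in> sets (iid p)" using sets.top[of "iid p"] by simp
  from measure_iid_head_tail[OF this, of S] show ?case
    using prob_space.prob_space[OF prob_space_iid[of p]] by simp
next
  case (Suc n)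
  then show ?case
    using measure_iid_tail[OF snth_event_sets[of "\<lambda>x. x \<in> S" n p]] by simp
qed

text \<open>Measurability is part of the claim because the induction step feeds the cylinder of the
  remaining word to \<open>measure_iid_head_tail\<close>.\<close>

lemma measure_iid_cylinder:
  assumes "B \<in> sets (iid p)"
  shows "measure (iid p) {\<omega>. stake (length xs) \<omega> = xs \<and> sdrop (length xs) \<omega> \<in> B}
    = prod_list (map (pmf p) xs) * measure (iid p) B
    \<and> {\<omega>. stake (length xs) \<omega> = xs \<and> sdrop (length xs) \<omega> \<in> B} \<in> sets (iid p)"
proof (induction xs)
  case Nil
  then show ?case using assms by simp
next
  case (Cons x xs)
  let ?C = "{\<omega>. stake (length xs) \<omega> = xs \<and> sdrop (length xs) \<omega> \<in> B}"
  have *: "{\<omega>. stake (length (x # xs)) \<omega> = x # xs \<and> sdrop (length (x # xs)) \<omega> \<in> B}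
     = {\<omega>. shd \<omega> \<in> {x} \<and> stl \<omega> \<in> ?C}" by auto
  have "{\<omega>. shd \<omega> \<in> {x} \<and> stl \<omega> \<in> ?C} \<in> sets (iid p)"
    using head_tail_sets Cons by blast
  moreover have "measure (iid p) {\<omega>. shd \<omega> \<in> {x} \<and> stl \<omega> \<in> ?C} = measure_pmf.prob p {x} * measure (iid p) ?C"
    using measure_iid_head_tail Cons by blast
  ultimately show ?case unfolding * using Cons by (simp add: measure_pmf_single)
qed

text \<open>Given that some loss among the first \<open>K\<close> exceeds \<open>M\<close>, the first such loss exceeds \<open>f\<close>
  with probability \<open>p {f<..} / p {M<..}\<close>.\<close>

lemma first_large_loss_prob:
  fixes M f :: nat
  assumes "M \<le> f"
  defines "E \<equiv> \<lambda>K. {\<omega>. \<exists>k<K. f < \<omega> !! k \<and> (\<forall>j<k. \<omega> !! j \<le> M)}"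
  shows "measure_pmf.prob p {M<..} * measure (iid p) (E K)
    = measure_pmf.prob p {f<..} * (1 - (1 - measure_pmf.prob p {M<..}) ^ K)"
proof (induction K)
  case 0
  then show ?case by (simp add: E_def)
next
  case (Suc K)
  interpret I: prob_space "iid p" by (rule prob_space_iid)
  let ?T = "measure_pmf.prob p {M<..}" and ?s = "measure_pmf.prob p {f<..}"
  have meas: "E k \<in> sets (iid p)" for k
    unfolding E_def by (rule snth_events_sets)
  let ?A = "{\<omega>. shd \<omega> \<in> {f<..} \<and> stl \<omega> \<in> UNIV}" and ?B = "{\<omega>. shd \<omega> \<in> {..M} \<and> stl \<omega> \<in> E K}"
  \<comment> \<open>First-step analysis: a first loss above \<open>f\<close> settles the event, one
    above \<open>M\<close> but not above \<open>f\<close> kills it, and after one of at most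
    \<open>M\<close> the event starts afresh.\<close>
  have eq: "E (Suc K) = ?A \<union> ?B"
  proof (intro set_eqI iffI)
    fix \<omega> assume "\<omega> \<in> E (Suc K)"
    then obtain k where k: "k < Suc K" "f < \<omega> !! k" "\<forall>j<k. \<omega> !! j \<le> M" by (auto simp: E_def)
    show "\<omega> \<in> ?A \<union> ?B"
    proof (cases k)
      case 0 with k show ?thesis by simp
    next
      case (Suc k')
      have "\<forall>j<k'. stl \<omega> !! j \<le> M"
        using k(3) Suc by (metis Suc_mono snth.simps(2))
      moreover have "shd \<omega> \<le> M" using k(3) Suc by (metis snth.simps(1) zero_less_Suc)
      ultimately show ?thesis using k Suc by (auto simp: E_def)
    qed
  next
    fix \<omega> assume "\<omega> \<in> ?A \<union> ?B"
    then show "\<omega> \<in> E (Suc K)"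
    proof
      assume "\<omega> \<in> ?A" then show ?thesis unfolding E_def by (auto intro!: exI[of _ 0])
    next
      assume "\<omega> \<in> ?B"
      then obtain k where "k < K" "f < stl \<omega> !! k" "\<forall>j<k. stl \<omega> !! j \<le> M" "shd \<omega> \<le> M"
        by (auto simp: E_def)
      then have "\<forall>j<Suc k. \<omega> !! j \<le> M" by (metis less_Suc_eq_0_disj snth.simps)
      with \<open>k < K\<close> \<open>f < stl \<omega> !! k\<close> show ?thesis unfolding E_def by (auto intro!: exI[of _ "Suc k"])
    qed
  qed
  have As: "?A \<in> sets (iid p)" using snth_event_sets[of "\<lambda>x. x \<in> {f<..}" 0 p] by simp
  have Bs: "?B \<in> sets (iid p)" by (rule head_tail_sets[OF meas])
  have "measure_pmf.prob p {..M} = 1 - ?T"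
    using measure_pmf.prob_compl[of "{M<..}" p] by (simp add: Compl_eq_Diff_UNIV[symmetric])
  then have mB: "measure (iid p) ?B = (1 - ?T) * measure (iid p) (E K)"
    using measure_iid_head_tail[OF meas] by metis
  have mA: "measure (iid p) ?A = ?s"
    using measure_iid_snth[of p 0 "{f<..}"] by simp
  have "?A \<inter> ?B = {}" using assms(1) by auto
  then have "measure (iid p) (E (Suc K)) = ?s + (1 - ?T) * measure (iid p) (E K)"
    unfolding eq using I.finite_measure_Union[OF As Bs] mA mB by simp
  \<comment> \<open>Multiplying by \<open>?T\<close> instead of dividing keeps the case
    \<open>?T = 0\<close> inside the induction.\<close>
  then have "?T * measure (iid p) (E (Suc K)) = ?T * ?s + (1 - ?T) * (?T * measure (iid p) (E K))"
    by (metis distrib_left mult.left_commute)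
  also have "\<dots> = ?s * (1 - (1 - ?T) ^ Suc K)"
    unfolding Suc by (simp add: algebra_simps)
  finally show ?case .
qed

section \<open>The distance between distributions\<close>

text \<open>The bound \<open>ln x \<le> x - 1\<close> is applied to the square root of
  \<open>m / a\<close> rather than to \<open>m / a\<close>, which retains a squared Hellinger term.
  For \<open>m = 0 < a\<close> the quotient would be the default value 0 and the bound would be
  lost.\<close>

lemma ln_div_mean_ge:
  fixes a m :: real
  assumes "a \<ge> 0" "m \<ge> 0" "m = 0 \<longrightarrow> a = 0"
  shows "a * ln (a / m) \<ge> (sqrt a - sqrt m)\<^sup>2 + a - m"
proof (cases "a = 0")
  case False
  with assms have a: "a > 0" "m > 0" by auto
  have "ln (sqrt (m / a)) \<le> sqrt (m / a) - 1" using a by (intro ln_le_minus_one) auto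
  moreover have "ln (sqrt (m / a)) = - ln (a / m) / 2" using a by (simp add: ln_sqrt ln_div)
  ultimately have "ln (a / m) \<ge> 2 - 2 * sqrt (m / a)" by simp
  then have "a * ln (a / m) \<ge> a * (2 - 2 * sqrt (m / a))" using a by (intro mult_left_mono) auto
  also have "a * (2 - 2 * sqrt (m / a)) = 2 * a - 2 * (sqrt a * sqrt m)"
  proof -
    have "a * sqrt (m / a) = sqrt a * sqrt m"
      using a by (simp add: real_sqrt_divide field_simps)
    then show ?thesis by (simp add: algebra_simps)
  qed
  also have "\<dots> = (sqrt a - sqrt m)\<^sup>2 + a - m"
    using a by (simp add: power2_diff)
  finally show ?thesis by simp
qed (use assms in auto)

text \<open>The two summands are merged since each alone can be negative while their sum cannot, so
  that a single coordinate is bounded by the whole series.\<close>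

definition js_term :: "real \<Rightarrow> real \<Rightarrow> real" where
  "js_term a b = a * log 2 (a / ((a + b) / 2)) + b * log 2 (b / ((a + b) / 2))"

text \<open>From \<open>ln x \<le> x - 1\<close>; the remaining weight \<open>a / (a + b)\<close> is
  at most 1.\<close>

lemma kl_term_upper:
  fixes a b :: real
  assumes "a \<ge> 0" "b \<ge> 0"
  shows "a * log 2 (a / ((a + b) / 2)) \<le> \<bar>a - b\<bar> / ln 2"
proof (cases "a = 0")
  case False
  with assms have a: "a > 0" by auto
  let ?m = "(a + b) / 2"
  have m: "?m > 0" using a assms by auto
  have "ln (a / ?m) \<le> a / ?m - 1" using a m by (intro ln_le_minus_one) auto
  then have "a * ln (a / ?m) \<le> a * (a / ?m - 1)" using a by (intro mult_left_mono) auto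
  also have "\<dots> = (a / (a + b)) * (a - b)" using a m assms by (simp add: field_simps)
  also have "\<dots> \<le> (a / (a + b)) * \<bar>a - b\<bar>" using a assms by (intro mult_left_mono) auto
  also have "\<dots> \<le> 1 * \<bar>a - b\<bar>" using a assms by (intro mult_right_mono) auto
  finally show ?thesis by (simp add: log_def divide_right_mono)
qed auto

text \<open>Crude, but together with the upper bound it dominates the series absolutely.\<close>

lemma kl_term_lower:
  fixes a b :: real
  assumes "a \<ge> 0" "b \<ge> 0"
  shows "a * log 2 (a / ((a + b) / 2)) \<ge> - (a + b) / ln 2"
proof -
  define m where "m = (a + b) / 2"
  have "a * ln (a / m) \<ge> (sqrt a - sqrt m)\<^sup>2 + a - m"
    using assms by (intro ln_div_mean_ge) (auto simp: m_def)
  moreover have "(sqrt a - sqrt m)\<^sup>2 \<ge> 0" by simp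
  moreover have "a - m \<ge> - (a + b)" using assms by (simp add: m_def field_simps)
  ultimately have "a * ln (a / m) \<ge> - (a + b)" by linarith
  then have "- (a + b) / ln 2 \<le> a * ln (a / m) / ln 2" by (intro divide_right_mono) auto
  then show ?thesis by (simp add: log_def m_def)
qed

text \<open>Both logarithms are bounded relative to the midpoint, where the linear parts
  \<open>a - ?m\<close> and \<open>b - ?m\<close> cancel;
  \<open>(x + y - 2 * z)\<^sup>2 \<ge> 0\<close> then eliminates the midpoint. Base 2 only helps, as
  \<open>ln 2 \<le> 1\<close>.\<close>

lemma js_term_ge:
  fixes a b :: real
  assumes "a \<ge> 0" "b \<ge> 0"
  shows "js_term a b \<ge> (sqrt a - sqrt b)\<^sup>2 / 2"
proof -
  let ?m = "(a + b) / 2"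
  have 1: "a * ln (a / ?m) \<ge> (sqrt a - sqrt ?m)\<^sup>2 + a - ?m"
    using assms by (intro ln_div_mean_ge) auto
  have 2: "b * ln (b / ?m) \<ge> (sqrt b - sqrt ?m)\<^sup>2 + b - ?m"
    using assms by (intro ln_div_mean_ge) auto
  have "(x - y)\<^sup>2 / 2 \<le> (x - z)\<^sup>2 + (y - z)\<^sup>2" for x y z :: real
    using zero_le_power2[of "x + y - 2 * z"] by (simp add: power2_eq_square field_simps)
  then have "(sqrt a - sqrt b)\<^sup>2 / 2 \<le> (sqrt a - sqrt ?m)\<^sup>2 + (sqrt b - sqrt ?m)\<^sup>2" .
  also have "\<dots> \<le> a * ln (a / ?m) + b * ln (b / ?m)" using 1 2 by (simp add: field_simps)
  finally have h: "(sqrt a - sqrt b)\<^sup>2 / 2 \<le> a * ln (a / ?m) + b * ln (b / ?m)" .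
  have ln2: "(0::real) < ln 2" "ln 2 \<le> (1::real)" using ln_le_minus_one[of 2] by auto
  have "(sqrt a - sqrt b)\<^sup>2 / 2 * ln 2 \<le> (sqrt a - sqrt b)\<^sup>2 / 2 * 1"
    using ln2 by (intro mult_left_mono) auto
  with h have "(sqrt a - sqrt b)\<^sup>2 / 2 * ln 2 \<le> a * ln (a / ?m) + b * ln (b / ?m)" by linarith
  then have "(sqrt a - sqrt b)\<^sup>2 / 2 \<le> (a * ln (a / ?m) + b * ln (b / ?m)) / ln 2"
    using ln2(1) by (simp only: pos_le_divide_eq)
  then show ?thesis by (simp add: js_term_def log_def add_divide_distrib)
qed

section \<open>Convergence of the series behind the distance\<close>

lemma pmf_sums: "summable (pmf (p :: nat pmf))" "(\<Sum>y. pmf p y) = 1"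
proof -
  have "(\<lambda>y. measure_pmf.prob p {y}) sums measure_pmf.prob p (\<Union>y. {y})"
    by (rule measure_pmf.finite_measure_UNION) (auto simp: disjoint_family_on_def)
  then have "pmf p sums 1" by (simp add: measure_pmf_single UNION_singleton_eq_range)
  then show "summable (pmf p)" "(\<Sum>y. pmf p y) = 1" by (auto simp: sums_iff)
qed

lemma pmf_diff_summable: "summable (\<lambda>y. \<bar>pmf p y - pmf q y\<bar>)" for p q :: "nat pmf"
  by (rule summable_comparison_test[OF _ summable_add[OF pmf_sums(1)[of p] pmf_sums(1)[of q]]])
    (auto intro!: exI[of _ 0] simp: abs_le_iff add_increasing add_increasing2)

text \<open>Without convergence the sum in \<open>KL\<close> would be a meaningless default, and the
  two series could not be added term by term.\<close>

lemma kl_mean_summable: "summable (\<lambda>y. pmf p y * log 2 (pmf p y / ((pmf p y + pmf q y) / 2)))"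
  for p q :: "nat pmf"
proof (rule summable_comparison_test)
  show "summable (\<lambda>y. (pmf p y + pmf q y) / ln 2)"
    by (intro summable_divide summable_add pmf_sums)
  have "norm (pmf p y * log 2 (pmf p y / ((pmf p y + pmf q y) / 2))) \<le> (pmf p y + pmf q y) / ln 2" for y
  proof -
    have "\<bar>pmf p y - pmf q y\<bar> / ln 2 \<le> (pmf p y + pmf q y) / ln 2"
      by (intro divide_right_mono) (auto simp: abs_le_iff add_increasing add_increasing2)
    then show ?thesis
      using kl_term_upper[of "pmf p y" "pmf q y"] kl_term_lower[of "pmf p y" "pmf q y"]
      by (simp add: abs_le_iff minus_divide_left[symmetric] del: minus_add_distrib)
  qed
  then show "\<exists>N. \<forall>y\<ge>N. norm (pmf p y * log 2 (pmf p y / ((pmf p y + pmf q y) / 2)))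
    \<le> (pmf p y + pmf q y) / ln 2" by blast
qed

lemma distJS_sums: "(\<lambda>y. js_term (pmf p y) (pmf q y)) sums distJS p q"
proof -
  have "(\<lambda>y. pmf p y * log 2 (pmf p y / ((pmf p y + pmf q y) / 2))
      + pmf q y * log 2 (pmf q y / ((pmf q y + pmf p y) / 2))) sums
      ((\<Sum>y. pmf p y * log 2 (pmf p y / ((pmf p y + pmf q y) / 2))) +
       (\<Sum>y. pmf q y * log 2 (pmf q y / ((pmf q y + pmf p y) / 2))))"
    by (intro sums_add summable_sums kl_mean_summable)
  then show ?thesis unfolding js_term_def distJS_def KL_def Let_def by (simp add: add.commute)
qed

lemma distJS_le_l1: "distJS p q \<le> 2 / ln 2 * (\<Sum>y. \<bar>pmf p y - pmf q y\<bar>)"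
proof -
  have "js_term (pmf p y) (pmf q y) \<le> 2 / ln 2 * \<bar>pmf p y - pmf q y\<bar>" for y
    using kl_term_upper[of "pmf p y" "pmf q y"] kl_term_upper[of "pmf q y" "pmf p y"]
    by (simp add: js_term_def add.commute abs_minus_commute)
  then have "(\<Sum>y. js_term (pmf p y) (pmf q y)) \<le> (\<Sum>y. 2 / ln 2 * \<bar>pmf p y - pmf q y\<bar>)"
    using distJS_sums by (intro suminf_le summable_mult pmf_diff_summable) (auto simp: sums_iff)
  also have "\<dots> = 2 / ln 2 * (\<Sum>y. \<bar>pmf p y - pmf q y\<bar>)"
    by (rule suminf_mult[OF pmf_diff_summable])
  finally show ?thesis using distJS_sums[of p q] by (simp add: sums_iff)
qed

text \<open>Small distance forces pointwise closeness. The constant 8 is the 2 from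
  \<open>js_term_ge\<close> times the bound 4 on \<open>(sqrt ?a + sqrt ?b)\<^sup>2\<close>.\<close>

lemma pmf_diff_le_distJS: "(pmf p y - pmf q y)\<^sup>2 \<le> 8 * distJS p q"
proof -
  let ?a = "pmf p y" and ?b = "pmf q y"
  have nonneg: "0 \<le> js_term (pmf p z) (pmf q z)" for z
    using js_term_ge[of "pmf p z" "pmf q z"] by (smt (verit) pmf_nonneg zero_le_power2 half_gt_zero divide_nonneg_nonneg)
  have "js_term ?a ?b = (\<Sum>z\<in>{y}. js_term (pmf p z) (pmf q z))" by simp
  also have "\<dots> \<le> distJS p q"
    using distJS_sums[of p q] sum_le_suminf[of "\<lambda>z. js_term (pmf p z) (pmf q z)" "{y}"] nonneg
    by (simp add: sums_iff)
  finally have *: "(sqrt ?a - sqrt ?b)\<^sup>2 \<le> 2 * distJS p q"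
    using js_term_ge[of ?a ?b] by simp
  have "?a - ?b = (sqrt ?a - sqrt ?b) * (sqrt ?a + sqrt ?b)"
    by (simp add: algebra_simps)
  then have "(?a - ?b)\<^sup>2 = (sqrt ?a - sqrt ?b)\<^sup>2 * (sqrt ?a + sqrt ?b)\<^sup>2"
    by (simp add: power_mult_distrib)
  also have "\<dots> \<le> (sqrt ?a - sqrt ?b)\<^sup>2 * 2\<^sup>2"
  proof (intro mult_left_mono power_mono)
    have "sqrt ?a \<le> 1" "sqrt ?b \<le> 1" by (auto simp: pmf_le_1)
    then show "sqrt ?a + sqrt ?b \<le> 2" by linarith
  qed auto
  finally show ?thesis using * by simp
qed

text \<open>The argument of Scheffe: since both masses are 1, the tail of \<open>q\<close> is at
  most that of \<open>p\<close> plus the discrepancy below \<open>m\<close>.\<close>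

lemma l1_le_finite_part:
  fixes p q :: "nat pmf"
  shows "(\<Sum>y. \<bar>pmf p y - pmf q y\<bar>) \<le> 2 * (\<Sum>y<m. \<bar>pmf p y - pmf q y\<bar>) + 2 * measure_pmf.prob p {m..}"
proof -
  let ?S = "\<Sum>y<m. \<bar>pmf p y - pmf q y\<bar>"
  have tail: "measure_pmf.prob r {m..} = 1 - (\<Sum>y<m. pmf r y)" for r :: "nat pmf"
    using measure_pmf.prob_compl[of "{..<m}" r] measure_measure_pmf_finite[of "{..<m}" r]
    by (simp add: Compl_eq_Diff_UNIV[symmetric])
  have ptail: "(\<Sum>y. pmf r (y + m)) = measure_pmf.prob r {m..}" for r :: "nat pmf"
    using suminf_minus_initial_segment[OF pmf_sums(1)[of r], of m] pmf_sums(2)[of r] tail by simp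
  have "(\<Sum>y. \<bar>pmf p y - pmf q y\<bar>) = (\<Sum>y. \<bar>pmf p (y + m) - pmf q (y + m)\<bar>) + ?S"
    by (rule suminf_split_initial_segment[OF pmf_diff_summable])
  also have "(\<Sum>y. \<bar>pmf p (y + m) - pmf q (y + m)\<bar>) \<le> (\<Sum>y. pmf p (y + m) + pmf q (y + m))"
    using pmf_diff_summable[of p q] pmf_sums(1)
    by (intro suminf_le summable_add)
      (auto simp: summable_iff_shift[of _ m] summable_iff_shift[of "\<lambda>y. \<bar>pmf p y - pmf q y\<bar>" m]
        abs_le_iff add_increasing add_increasing2)
  also have "\<dots> = measure_pmf.prob p {m..} + measure_pmf.prob q {m..}"
    using pmf_sums(1) by (subst suminf_add[symmetric]) (auto simp: ptail summable_iff_shift)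
  also have "measure_pmf.prob q {m..} \<le> measure_pmf.prob p {m..} + ?S"
  proof -
    have "(\<Sum>y<m. pmf p y) - (\<Sum>y<m. pmf q y) \<le> ?S"
      unfolding sum_subtractf[symmetric] by (intro sum_mono) auto
    then show ?thesis unfolding tail by simp
  qed
  finally show ?thesis by simp
qed

lemma tail_vanishes:
  assumes "\<epsilon> > 0"
  shows "\<exists>m::nat. measure_pmf.prob p {m..} < \<epsilon>"
proof -
  have "(\<lambda>m. measure_pmf.prob p {m..}) \<longlonglongrightarrow> measure_pmf.prob p (\<Inter>m. {m..})"
    by (rule measure_pmf.finite_Lim_measure_decseq) (auto simp: decseq_def)
  also have "(\<Inter>m. {m::nat..}) = {}" by (metis (no_types, lifting) INT_iff Suc_n_not_le_n UNIV_I atLeast_iff equals0I)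
  finally have "(\<lambda>m. measure_pmf.prob p {m..}) \<longlonglongrightarrow> 0" by simp
  from order_tendstoD(2)[OF this assms] show ?thesis by (auto simp: eventually_sequentially)
qed

lemma distJS_small_if_close_on_prefix:
  assumes "\<epsilon> > 0"
  shows "\<exists>m r. r > 0 \<and> (\<forall>q. (\<forall>y<m. \<bar>pmf p y - pmf q y\<bar> \<le> r) \<longrightarrow> distJS p q < \<epsilon>)"
proof -
  \<comment> \<open>The head and the tail contribute at most \<open>2 * c\<close> each to the L1
    distance, and \<open>2 / ln 2 * (4 * c) = \<epsilon>\<close>.\<close>
  define c :: real where "c = \<epsilon> * ln 2 / 8"
  have c: "c > 0" using assms by (simp add: c_def)
  obtain m where m: "measure_pmf.prob p {m..} < c" using tail_vanishes[OF c] by blast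
  define r where "r = c / real (Suc m)"
  have "distJS p q < \<epsilon>" if q: "\<forall>y<m. \<bar>pmf p y - pmf q y\<bar> \<le> r" for q
  proof -
    have "(\<Sum>y<m. \<bar>pmf p y - pmf q y\<bar>) \<le> real m * r"
      using sum_bounded_above[of "{..<m}" "\<lambda>y. \<bar>pmf p y - pmf q y\<bar>" r] q by simp
    also have "\<dots> \<le> c" using c by (simp add: r_def field_simps)
    finally have "(\<Sum>y. \<bar>pmf p y - pmf q y\<bar>) < 4 * c"
      using l1_le_finite_part[of p q m] m by linarith
    then have "2 / ln 2 * (\<Sum>y. \<bar>pmf p y - pmf q y\<bar>) < 2 / ln 2 * (4 * c)"
      by (intro mult_strict_left_mono) auto
    also have "\<dots> = \<epsilon>" by (simp add: c_def)
    finally show ?thesis using distJS_le_l1[of p q] by linarith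
  qed
  moreover have "r > 0" using c by (simp add: r_def)
  ultimately show ?thesis by blast
qed

section \<open>Quantiles and tails\<close>

lemma prob_greaterThan: "measure_pmf.prob q {n<..} = 1 - measure_pmf.prob q {..n}" for n :: nat
  using measure_pmf.prob_compl[of "{..n}" q] by (simp add: Compl_eq_Diff_UNIV[symmetric])

lemma finite_support_below: "finite {s \<in> set_pmf q. real s \<le> y}" for q :: "nat pmf"
  by (rule finite_subset[of _ "{..nat \<lfloor>y\<rfloor>}"]) (auto simp: le_nat_floor)

text \<open>Of \<open>Max\<close> and \<open>LEAST\<close> only the extremal properties are kept;
  they suffice for comparing \<open>Fcdf\<close> with the usual CDF.\<close>

lemma Fcdf_cases:
  fixes q :: "nat pmf" and y :: real
  obtains (below) "\<And>s. s \<in> set_pmf q \<Longrightarrow> y < real s" "Fcdf q y = 0"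
  | (above) "\<And>s. s \<in> set_pmf q \<Longrightarrow> real s \<le> y" "Fcdf q y = 1"
  | (between) a b where "real a \<le> y" "y < real b"
      "\<And>s. s \<in> set_pmf q \<Longrightarrow> real s \<le> y \<Longrightarrow> s \<le> a"
      "\<And>s. s \<in> set_pmf q \<Longrightarrow> y < real s \<Longrightarrow> b \<le> s"
      "Fcdf q y = measure_pmf.prob q {..a} + (y - real a) / (real b - real a) * pmf q b"
proof (cases "{s \<in> set_pmf q. real s \<le> y} = {}")
  case True
  then have "Fcdf q y = 0" by (simp only: Fcdf_def if_True simp_thms)
  moreover have "y < real s" if "s \<in> set_pmf q" for s using True that by force
  ultimately show ?thesis using below by blast
next
  case ne: False
  define a where "a = Max {s \<in> set_pmf q. real s \<le> y}"
  show ?thesis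
  proof (cases "{s \<in> set_pmf q. y < real s} = {}")
    case True
    with ne have "Fcdf q y = 1" by (simp only: Fcdf_def if_True if_False Let_def simp_thms)
    moreover have "real s \<le> y" if "s \<in> set_pmf q" for s using True that by force
    ultimately show ?thesis using above by blast
  next
    case False
    define b where "b = (LEAST s. s \<in> set_pmf q \<and> y < real s)"
    have a: "a \<in> {s \<in> set_pmf q. real s \<le> y}" unfolding a_def by (rule Max_in[OF finite_support_below ne])
    have b: "b \<in> set_pmf q \<and> y < real b" unfolding b_def
      by (rule LeastI_ex) (use False in blast)
    have "s \<le> a" if "s \<in> set_pmf q" "real s \<le> y" for s
      unfolding a_def using that by (intro Max_ge[OF finite_support_below]) auto
    moreover have "b \<le> s" if "s \<in> set_pmf q" "y < real s" for s
      unfolding b_def using that by (intro Least_le) auto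
    moreover have "Fcdf q y = measure_pmf.prob q {..a} + (y - real a) / (real b - real a) * pmf q b"
      using ne False unfolding Fcdf_def a_def[symmetric] b_def[symmetric] Let_def
      by (simp only: if_False)
    ultimately show ?thesis using a b between by blast
  qed
qed

text \<open>No mass lies between the last support point up to \<open>n\<close> and \<open>n\<close>
  itself, and interpolation only adds to the CDF there.\<close>

lemma Fcdf_ge_prob: "measure_pmf.prob q {..n} \<le> Fcdf q (real n)"
proof (cases q "real n" rule: Fcdf_cases)
  case below
  then have "set_pmf q \<inter> {..n} = {}" by force
  then have "measure_pmf.prob q {..n} = 0" by (simp add: measure_pmf_zero_iff)
  then show ?thesis using below by simp
next
  case (between a b)
  have "{..n} \<inter> set_pmf q \<subseteq> {..a} \<inter> set_pmf q" using between(3) by auto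
  then have "measure_pmf.prob q {..n} \<le> measure_pmf.prob q {..a}"
    using measure_pmf.finite_measure_mono[of "{..n} \<inter> set_pmf q" "{..a} \<inter> set_pmf q" q]
    by (simp add: measure_Int_set_pmf)
  moreover have "0 \<le> (real n - real a) / (real b - real a) * pmf q b" using between by auto
  ultimately show ?thesis using between(5) by linarith
qed auto

lemma prob_le_imp_Finv_le:
  assumes "measure_pmf.prob q {n<..} \<le> \<delta>"
  shows "Finv q (1 - \<delta>) \<le> real n"
  unfolding Finv_def
proof (rule cInf_lower)
  show "real n \<in> {y. 0 \<le> y \<and> 1 - \<delta> \<le> Fcdf q y}"
    using Fcdf_ge_prob[of q n] assms by (simp add: prob_greaterThan)
  show "bdd_below {y. 0 \<le> y \<and> 1 - \<delta> \<le> Fcdf q y}" by (rule bdd_belowI[of _ 0]) auto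
qed

text \<open>Interpolation can pull the quantile far below a large support point, but, after halving
  \<open>\<delta>\<close>, at most by the factor \<open>\<delta> / 2\<close>.\<close>

lemma Finv_ge_if_heavy_tail:
  assumes "\<delta> > 0" and tail: "measure_pmf.prob q {g<..} > \<delta>"
  shows "Finv q (1 - \<delta> / 2) \<ge> real g * \<delta> / 2"
  unfolding Finv_def
proof (rule cInf_greatest)
  have "\<delta> < 1" using tail measure_pmf.prob_le_1[of q "{g<..}"] by linarith
  \<comment> \<open>The infimum must not range over the empty set: the level
    \<open>1 - \<delta> / 2\<close> is below 1 and hence reached.\<close>
  obtain m where m: "measure_pmf.prob q {..m} \<ge> 1 - \<delta> / 2"
  proof -
    have "(\<lambda>m. measure_pmf.prob q {..m}) \<longlonglongrightarrow> measure_pmf.prob q (\<Union>m. {..m})"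
      by (rule measure_pmf.finite_Lim_measure_incseq) (auto simp: incseq_def)
    also have "(\<Union>m. {..m::nat}) = UNIV" by auto
    finally have "(\<lambda>m. measure_pmf.prob q {..m}) \<longlonglongrightarrow> 1" by simp
    from order_tendstoD(1)[OF this, of "1 - \<delta> / 2"] assms(1) that show ?thesis
      by (auto simp: eventually_sequentially intro: less_imp_le)
  qed
  then show "{y. 0 \<le> y \<and> 1 - \<delta> / 2 \<le> Fcdf q y} \<noteq> {}"
    using Fcdf_ge_prob[of q m] by (auto intro!: exI[of _ "real m"])
  fix y assume "y \<in> {y. 0 \<le> y \<and> 1 - \<delta> / 2 \<le> Fcdf q y}"
  then have y: "0 \<le> y" "1 - \<delta> / 2 \<le> Fcdf q y" by auto
  have head: "measure_pmf.prob q {..g} < 1 - \<delta>" using tail by (simp add: prob_greaterThan)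
  show "real g * \<delta> / 2 \<le> y"
  proof (rule ccontr)
    assume "\<not> real g * \<delta> / 2 \<le> y"
    then have lt: "y < real g * \<delta> / 2" by simp
    also have "\<dots> \<le> real g" using mult_left_mono[of "\<delta> / 2" 1 "real g"] \<open>\<delta> < 1\<close> by simp
    finally have yg: "y < real g" .
    show False
    proof (cases q y rule: Fcdf_cases)
      case below
      with y \<open>\<delta> < 1\<close> show False by simp
    next
      case above
      then have "set_pmf q \<subseteq> {..g}" using yg by force
      then have "measure_pmf.prob q {..g} = 1" by (subst measure_pmf.prob_eq_1) (auto simp: AE_measure_pmf_iff)
      with head assms(1) show False by simp
    next
      case (between a b)
      have ab: "a < b" using between(1,2) by linarith
      have w: "0 \<le> (y - real a) / (real b - real a)" "(y - real a) / (real b - real a) \<le> 1"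
        using between(1,2) by auto
      show False
      proof (cases "b \<le> g")
        \<comment> \<open>Even the full jump at \<open>b\<close> leaves the value at most the mass
          up to \<open>g\<close>, which is too small.\<close>
        case True
        have "(y - real a) / (real b - real a) * pmf q b \<le> pmf q b"
          using mult_right_mono[OF w(2), of "pmf q b"] by simp
        then have "Fcdf q y \<le> measure_pmf.prob q {..a} + measure_pmf.prob q {b}"
          unfolding between(5) by (simp add: measure_pmf_single)
        also have "\<dots> = measure_pmf.prob q ({..a} \<union> {b})"
          using ab by (subst measure_pmf.finite_measure_Union) auto
        also have "\<dots> \<le> measure_pmf.prob q {..g}"
          using True ab by (intro measure_pmf.finite_measure_mono) auto
        finally show False using head y assms(1) by linarith
      next
        \<comment> \<open>Interpolation alone must supply more than \<open>\<delta> / 2\<close>, so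
          \<open>y\<close> lies beyond that fraction of the way from \<open>a\<close> to
          \<open>b\<close>, and \<open>b\<close> exceeds \<open>g\<close>.\<close>
        case False
        have "measure_pmf.prob q {..a} \<le> measure_pmf.prob q {..g}"
          using between(1) yg by (intro measure_pmf.finite_measure_mono) auto
        moreover have "(y - real a) / (real b - real a) * pmf q b \<le> (y - real a) / (real b - real a)"
          using mult_left_mono[OF pmf_le_1 w(1), of q b] by simp
        ultimately have "\<delta> / 2 < (y - real a) / (real b - real a)"
          using y(2) head unfolding between(5) by linarith
        then have "\<delta> / 2 * (real b - real a) < y - real a"
          using ab by (simp add: less_divide_eq)
        moreover have "real g * \<delta> / 2 \<le> real b * \<delta> / 2" using False assms(1) by simp
        moreover have "real a * \<delta> / 2 \<le> real a" using mult_left_mono[of "\<delta> / 2" 1 "real a"] \<open>\<delta> < 1\<close> by simp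
        moreover have "\<delta> / 2 * (real b - real a) = real b * \<delta> / 2 - real a * \<delta> / 2"
          by (simp add: field_simps)
        ultimately show False using lt by linarith
      qed
    qed
  qed
qed

section \<open>Deceptiveness in terms of tails\<close>

lemma not_deceptive_imp_tight_ball:
  assumes "\<not> deceptive P p"
  shows "\<exists>\<epsilon>>0. \<forall>\<delta>>0. \<exists>g::nat. \<forall>q\<in>P. distJS p q < \<epsilon> \<longrightarrow> measure_pmf.prob q {g<..} \<le> \<delta>"
proof -
  obtain \<epsilon> where \<epsilon>: "\<epsilon> > 0" "\<And>\<delta>. \<delta> > 0 \<Longrightarrow> \<exists>f. \<forall>q\<in>P. distJS p q < \<epsilon> \<longrightarrow> Finv q (1 - \<delta>) \<le> f"
    using assms unfolding deceptive_def by (metis not_le)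
  have "\<exists>g::nat. \<forall>q\<in>P. distJS p q < \<epsilon> \<longrightarrow> measure_pmf.prob q {g<..} \<le> \<delta>" if "\<delta> > 0" for \<delta>
  proof -
    \<comment> \<open>Halving \<open>\<delta>\<close> pays for the interpolation; \<open>g\<close>
      is then taken large enough to absorb the factor \<open>\<delta> / 2\<close>.\<close>
    obtain f where f: "\<And>q. q \<in> P \<Longrightarrow> distJS p q < \<epsilon> \<Longrightarrow> Finv q (1 - \<delta> / 2) \<le> f"
      using \<epsilon>(2)[of "\<delta> / 2"] \<open>\<delta> > 0\<close> half_gt_zero by blast
    obtain g :: nat where "2 * f / \<delta> < real g" using reals_Archimedean2 by blast
    then have g: "f < real g * \<delta> / 2" using that by (simp add: field_simps)
    have "measure_pmf.prob q {g<..} \<le> \<delta>" if q: "q \<in> P" "distJS p q < \<epsilon>" for q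
      using Finv_ge_if_heavy_tail[OF \<open>\<delta> > 0\<close>, of q g] f[OF q] g by linarith
    then show ?thesis by blast
  qed
  with \<epsilon>(1) show ?thesis by blast
qed

text \<open>In this direction interpolation costs nothing, as \<open>Fcdf\<close> is at least the
  usual CDF at natural numbers, so the same \<open>\<delta>\<close> serves.\<close>

lemma deceptive_imp_escaping_mass:
  assumes "deceptive P p" "\<epsilon> > 0"
  shows "\<exists>\<delta>>0. \<forall>g::nat. \<exists>q\<in>P. distJS p q < \<epsilon> \<and> measure_pmf.prob q {g<..} > \<delta>"
proof -
  obtain \<delta> where "\<delta> > 0" and d: "\<And>f. \<exists>q\<in>P. distJS p q < \<epsilon> \<and> Finv q (1 - \<delta>) > f"
    using assms unfolding deceptive_def by blast
  moreover have "\<exists>q\<in>P. distJS p q < \<epsilon> \<and> measure_pmf.prob q {g<..} > \<delta>" for g :: nat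
    using d[of "real g"] prob_le_imp_Finv_le by (metis not_le)
  ultimately show ?thesis by blast
qed

section \<open>A deceptive distribution prevents insurability\<close>

lemma goes_bankrupt_sets: "{\<omega>. goes_bankrupt Pi0 \<tau> Prem \<omega>} \<in> sets (iid p)"
proof -
  have "{\<omega>. goes_bankrupt Pi0 \<tau> Prem \<omega>} = {\<omega>. \<exists>n. (\<lambda>n xs. n \<ge> 1 \<and>
      Pi0 + (\<Sum>i<n. (Prem (take i xs) - real (xs ! i)) * (if \<tau> (take i xs) then 1 else 0)) < 0) n (stake n \<omega>)}"
    unfolding goes_bankrupt_def by (simp add: take_stake min_absorb1 stake_nth)
  also have "\<dots> \<in> sets (iid p)" by (rule prefix_events_sets)
  finally show ?thesis .
qed

lemma scheme_active_mono:
  assumes "insurance_scheme P \<tau> Prem" "\<tau> (stake m \<omega>)" "m \<le> n"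
  shows "\<tau> (stake n \<omega>)"
  using assms(3,2)
proof (induction rule: dec_induct)
  case (step k)
  then show ?case using assms(1) unfolding insurance_scheme_def stake_Suc by blast
qed

text \<open>Earlier losses only lower the surplus, so all premiums so far bound it. The premium for
  the loss \<open>\<omega> !! n\<close> is set after \<open>n\<close> losses, hence the sum includes
  \<open>n\<close>.\<close>

lemma bankrupt_by_huge_loss:
  assumes scheme: "insurance_scheme P \<tau> Prem" and active: "\<tau> (stake n \<omega>)"
    and huge: "Pi0 + (\<Sum>i\<le>n. Prem (stake i \<omega>)) < real (\<omega> !! n)"
  shows "goes_bankrupt Pi0 \<tau> Prem \<omega>"
proof -
  let ?g = "\<lambda>i. (Prem (stake i \<omega>) - real (\<omega> !! i)) * (if \<tau> (stake i \<omega>) then 1 else 0)"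
  have nonneg: "Prem xs \<ge> 0" for xs using scheme by (simp add: insurance_scheme_def)
  have "(\<Sum>i<n. ?g i) \<le> (\<Sum>i<n. Prem (stake i \<omega>))" using nonneg by (intro sum_mono) auto
  moreover have "(\<Sum>i<Suc n. ?g i) = (\<Sum>i<n. ?g i) + (Prem (stake n \<omega>) - real (\<omega> !! n))"
    using active by simp
  moreover have "(\<Sum>i\<le>n. Prem (stake i \<omega>)) = (\<Sum>i<n. Prem (stake i \<omega>)) + Prem (stake n \<omega>)"
    by (simp add: lessThan_Suc_atMost[symmetric])
  ultimately have "Pi0 + (\<Sum>i<Suc n. ?g i) < 0" using huge by linarith
  then show ?thesis unfolding goes_bankrupt_def by (intro exI[of _ "Suc n"]) auto
qed

text \<open>Factors are exchanged one at a time, all others staying in the unit interval.\<close>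

lemma prod_list_pmf_close:
  assumes "\<And>y. \<bar>pmf p y - pmf q y\<bar> \<le> d"
  shows "\<bar>prod_list (map (pmf p) xs) - prod_list (map (pmf q) xs)\<bar> \<le> real (length xs) * d"
proof (induction xs)
  case (Cons x xs)
  let ?P = "prod_list (map (pmf p) xs)" and ?Q = "prod_list (map (pmf q) xs)"
  have P: "0 \<le> ?P \<and> ?P \<le> 1" by (induction xs) (auto simp: pmf_le_1 mult_le_one)
  have "\<bar>pmf p x * ?P - pmf q x * ?Q\<bar> = \<bar>(pmf p x - pmf q x) * ?P + pmf q x * (?P - ?Q)\<bar>"
    by (simp add: algebra_simps)
  also have "\<dots> \<le> \<bar>pmf p x - pmf q x\<bar> * ?P + pmf q x * \<bar>?P - ?Q\<bar>"
    using P abs_triangle_ineq[of "(pmf p x - pmf q x) * ?P" "pmf q x * (?P - ?Q)"] by (simp add: abs_mult)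
  also have "\<dots> \<le> \<bar>pmf p x - pmf q x\<bar> * 1 + 1 * \<bar>?P - ?Q\<bar>"
    using P by (intro add_mono mult_mono) (auto simp: pmf_le_1)
  also have "\<dots> \<le> d + real (length xs) * d"
    using Cons assms[of x] by simp
  finally show ?case by (simp add: algebra_simps)
qed simp

text \<open>The common length makes the cylinders disjoint, so independence of prefix and remainder
  follows by summation.\<close>

lemma measure_iid_prefix_in:
  assumes "B \<in> sets (iid p)" "finite A" "\<And>xs. xs \<in> A \<Longrightarrow> length xs = N"
  shows "measure (iid p) {\<omega>. stake N \<omega> \<in> A \<and> sdrop N \<omega> \<in> B}
    = (\<Sum>xs\<in>A. prod_list (map (pmf p) xs)) * measure (iid p) B"
proof -
  interpret I: prob_space "iid p" by (rule prob_space_iid)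
  let ?C = "\<lambda>xs. {\<omega>. stake (length xs) \<omega> = xs \<and> sdrop (length xs) \<omega> \<in> B}"
  have "{\<omega>. stake N \<omega> \<in> A \<and> sdrop N \<omega> \<in> B} = (\<Union>xs\<in>A. ?C xs)" using assms(3) by auto
  also have "measure (iid p) \<dots> = (\<Sum>xs\<in>A. measure (iid p) (?C xs))"
    using measure_iid_cylinder[OF assms(1)] assms(2,3)
    by (intro I.finite_measure_finite_Union) (auto simp: disjoint_family_on_def)
  finally show ?thesis using measure_iid_cylinder[OF assms(1)] by (simp add: sum_distrib_right)
qed

lemma measure_gt_if_union_gt:
  assumes "incseq S" "\<And>n. S n \<in> sets (iid p)" "measure (iid p) (\<Union>n. S n) > c"
  shows "\<exists>n. measure (iid p) (S n) > c"
proof -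
  interpret I: prob_space "iid p" by (rule prob_space_iid)
  have "(\<lambda>n. measure (iid p) (S n)) \<longlonglongrightarrow> measure (iid p) (\<Union>n. S n)"
    using assms by (intro I.finite_Lim_measure_incseq) auto
  from order_tendstoD(1)[OF this assms(3)] show ?thesis by (auto simp: eventually_sequentially)
qed

text \<open>Continuity from below is used twice, first in the time and then in the size of the
  losses. Finiteness of \<open>A\<close> is what makes its probability stable when \<open>p\<close>
  is replaced by a nearby law.\<close>

lemma finite_entry_set:
  assumes "insurance_scheme P \<tau> Prem" "p \<in> P" "c < 1"
  shows "\<exists>N M A. (\<forall>xs\<in>A. length xs = N \<and> set xs \<subseteq> {..M} \<and> \<tau> xs) \<and> finite A \<and>
    (\<Sum>xs\<in>A. prod_list (map (pmf p) xs)) > c"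
proof -
  have "measure (iid p) (\<Union>n. {\<omega>. \<tau> (stake n \<omega>)}) = 1"
    using assms(1,2) by (simp add: insurance_scheme_def Collect_ex_eq)
  then obtain N where N: "measure (iid p) {\<omega>. \<tau> (stake N \<omega>)} > c"
    using measure_gt_if_union_gt[of "\<lambda>n. {\<omega>. \<tau> (stake n \<omega>)}" p c] scheme_active_mono[OF assms(1)]
      prefix_event_sets assms(3) by (auto simp: incseq_def)
  define A where "A = (\<lambda>M. {xs. length xs = N \<and> set xs \<subseteq> {..M} \<and> \<tau> xs})"
  have fin: "finite (A M)" for M
    by (rule finite_subset[OF _ finite_lists_length_eq[of "{..M}" N]]) (auto simp: A_def)
  have "(\<Union>M. {\<omega>. stake N \<omega> \<in> A M}) = {\<omega>. \<tau> (stake N \<omega>)}"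
  proof (intro set_eqI iffI)
    fix \<omega> assume "\<omega> \<in> {\<omega>. \<tau> (stake N \<omega>)}"
    moreover have "set (stake N \<omega>) \<subseteq> {..Max (set (stake N \<omega>))}" by auto
    ultimately show "\<omega> \<in> (\<Union>M. {\<omega>. stake N \<omega> \<in> A M})" by (auto simp: A_def)
  qed (auto simp: A_def)
  moreover have "incseq (\<lambda>M. {\<omega>. stake N \<omega> \<in> A M})" unfolding incseq_def A_def by fastforce
  ultimately obtain M where M: "measure (iid p) {\<omega>. stake N \<omega> \<in> A M} > c"
    using measure_gt_if_union_gt[of "\<lambda>M. {\<omega>. stake N \<omega> \<in> A M}" p c] prefix_event_sets N by auto
  have "UNIV \<in> sets (iid p)" using sets.top[of "iid p"] by simp
  from measure_iid_prefix_in[OF this fin, of M N]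
  have "measure (iid p) {\<omega>. stake N \<omega> \<in> A M} = (\<Sum>xs\<in>A M. prod_list (map (pmf p) xs))"
    using prob_space.prob_space[OF prob_space_iid[of p]] by (simp add: A_def)
  with M have "(\<Sum>xs\<in>A M. prod_list (map (pmf p) xs)) > c" by simp
  moreover have "\<forall>xs\<in>A M. length xs = N \<and> set xs \<subseteq> {..M} \<and> \<tau> xs" by (simp add: A_def)
  ultimately show ?thesis using fin by blast
qed

text \<open>The bounds \<open>3/4 * \<theta>\<close> and \<open>3/2 * \<theta>\<close> come from \<open>\<theta>\<close> being the limit, as \<open>g\<close> tends to infinity,
  of the largest mass that a member of the family can have above \<open>g\<close>.\<close>

lemma escaping_mass_limit:
  fixes B :: "nat pmf set"
  assumes "\<delta> > 0" "\<And>g::nat. \<exists>q\<in>B. measure_pmf.prob q {g<..} > \<delta>"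
  shows "\<exists>\<theta>>0. \<theta> \<le> 1 \<and> (\<exists>M. \<forall>q\<in>B. measure_pmf.prob q {M<..} \<le> 3/2 * \<theta>) \<and>
    (\<forall>g. \<exists>q\<in>B. measure_pmf.prob q {g<..} > 3/4 * \<theta>)"
proof -
  define D where "D = {d. \<forall>g::nat. \<exists>q\<in>B. measure_pmf.prob q {g<..} > d}"
  have D: "\<delta> \<in> D" using assms by (auto simp: D_def)
  have le1: "d \<le> 1" if d: "d \<in> D" for d
  proof -
    obtain q :: "nat pmf" where "measure_pmf.prob q {0<..} > d" using d unfolding D_def by blast
    then show ?thesis using measure_pmf.prob_le_1[of q "{0<..}"] by linarith
  qed
  then have bdd: "bdd_above D" by (rule bdd_aboveI)
  define \<theta> where "\<theta> = Sup D"
  have pos: "0 < \<theta>" using cSup_upper[OF D bdd] assms(1) by (simp add: \<theta>_def)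
  have "\<theta> \<le> 1" unfolding \<theta>_def using D le1 by (intro cSup_least) auto
  have "3/4 * \<theta> < Sup D" using pos by (simp add: \<theta>_def)
  then obtain d where d: "d \<in> D" "3/4 * \<theta> < d" using D by (subst (asm) less_cSup_iff[OF _ bdd]) auto
  have "3/2 * \<theta> \<notin> D"
    using cSup_upper[OF _ bdd, of "3/2 * \<theta>"] pos by (auto simp: \<theta>_def[symmetric])
  then obtain M :: nat where M: "\<And>q. q \<in> B \<Longrightarrow> measure_pmf.prob q {M<..} \<le> 3/2 * \<theta>"
    unfolding D_def by (auto simp: not_less)
  have "\<exists>q\<in>B. measure_pmf.prob q {g<..} > 3/4 * \<theta>" for g :: nat
  proof -
    from d(1) obtain q where "q \<in> B" "measure_pmf.prob q {g<..} > d" unfolding D_def by blast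
    with d(2) show ?thesis by (intro bexI[of _ q]) auto
  qed
  with pos \<open>\<theta> \<le> 1\<close> M show ?thesis by (intro exI[of _ \<theta>]) auto
qed

lemma deceptive_imp_not_insurable:
  assumes "p \<in> P" "deceptive P p"
  shows "\<not> insurable P Pi0"
proof
  assume "insurable P Pi0"
  \<comment> \<open>The bound 1/8 will be contradicted by entry with probability at least 1/2 and
    ruin thereafter with probability at least 1/4.\<close>
  then have "\<exists>\<tau> Prem. insurance_scheme P \<tau> Prem \<and>
      (\<forall>q\<in>P. measure (iid q) {\<omega>. goes_bankrupt Pi0 \<tau> Prem \<omega>} < 1/8)"
    unfolding insurable_def by (rule allE[where x = "1/8"]) simp
  then obtain \<tau> Prem where scheme: "insurance_scheme P \<tau> Prem"
    and safe: "\<And>q. q \<in> P \<Longrightarrow> measure (iid q) {\<omega>. goes_bankrupt Pi0 \<tau> Prem \<omega>} < 1/8"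
    by blast
  have three_quarters: "(3/4::real) < 1" by simp
  obtain N M0 A where A0: "\<forall>xs\<in>A. length xs = N \<and> set xs \<subseteq> {..M0} \<and> \<tau> xs"
    and A: "finite A" "(\<Sum>xs\<in>A. prod_list (map (pmf p) xs)) > 3/4"
    using finite_entry_set[OF scheme assms(1) three_quarters] by blast
  \<comment> \<open>Chosen so that errors of \<open>real N * d\<close> on each word of
    \<open>A\<close> cost at most 1/4 in all; adding 1 keeps the denominator positive.\<close>
  define d :: real where "d = 1 / (4 * (real (card A) * real N + 1))"
  have "d > 0" unfolding d_def by (intro divide_pos_pos mult_pos_pos add_nonneg_pos) auto
  have Ad: "real (card A) * (real N * d) \<le> 1/4"
  proof -
    have "real (card A) * real N + 1 > 0" by (intro add_nonneg_pos) auto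
    then show ?thesis unfolding d_def by (simp add: field_simps)
  qed
  \<comment> \<open>By \<open>pmf_diff_le_distJS\<close> this radius yields pointwise distance at
    most \<open>d\<close>.\<close>
  define B where "B = {q \<in> P. distJS p q < d\<^sup>2 / 8}"
  have entry: "(\<Sum>xs\<in>A. prod_list (map (pmf q) xs)) \<ge> 1/2" if q: "q \<in> B" for q
  proof -
    have close: "\<bar>pmf p y - pmf q y\<bar> \<le> d" for y
    proof -
      have "(pmf p y - pmf q y)\<^sup>2 \<le> d\<^sup>2"
        using pmf_diff_le_distJS[of p y q] q by (simp add: B_def)
      then show ?thesis using \<open>d > 0\<close> by (simp add: abs_le_square_iff[symmetric])
    qed
    have "(\<Sum>xs\<in>A. prod_list (map (pmf p) xs)) - (\<Sum>xs\<in>A. prod_list (map (pmf q) xs)) \<le> (\<Sum>xs\<in>A. real N * d)"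
      unfolding sum_subtractf[symmetric]
      using prod_list_pmf_close[of p q d, OF close] A0 by (intro sum_mono) (metis abs_le_D1)
    with A(2) Ad show ?thesis by simp
  qed
  have "d\<^sup>2 / 8 > 0" using \<open>d > 0\<close> by simp
  from deceptive_imp_escaping_mass[OF assms(2) this] obtain \<delta> where \<delta>: "\<delta> > 0"
    "\<And>g::nat. \<exists>q\<in>P. distJS p q < d\<^sup>2 / 8 \<and> measure_pmf.prob q {g<..} > \<delta>" by blast
  have "\<exists>q\<in>B. measure_pmf.prob q {g<..} > \<delta>" for g :: nat
    using \<delta>(2)[of g] by (auto simp: B_def)
  from escaping_mass_limit[OF \<delta>(1) this] obtain \<theta> M1 where \<theta>: "0 < \<theta>" "\<theta> \<le> 1"
    and M1: "\<And>q. q \<in> B \<Longrightarrow> measure_pmf.prob q {M1<..} \<le> 3/2 * \<theta>"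
    and esc: "\<And>g::nat. \<exists>q\<in>B. measure_pmf.prob q {g<..} > 3/4 * \<theta>"
    by blast
  \<comment> \<open>Taking \<open>M\<close> at least \<open>M0\<close> leaves the words of
    \<open>A\<close> without losses above \<open>M\<close>.\<close>
  define M where "M = max M0 M1"
  \<comment> \<open>Within \<open>K\<close> losses one above \<open>M\<close> occurs with
    probability more than 1/2 for every law with more than \<open>3/4 * \<theta>\<close> above
    \<open>M\<close>; \<open>K\<close> is fixed before \<open>q\<close>.\<close>
  obtain K where K: "(1 - 3/4 * \<theta>) ^ K < 1/2"
    using real_arch_pow_inv[of "1/2" "1 - 3/4 * \<theta>"] \<theta> by auto
  \<comment> \<open>All words on which a premium can be set until the first loss above
    \<open>M\<close>. Their premiums have a finite total, fixed before \<open>q\<close>.\<close>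
  define L where "L = {xs. set xs \<subseteq> {..M} \<and> length xs \<le> N + K}"
  have "finite L" unfolding L_def by (rule finite_lists_length_le) simp
  obtain f0 :: nat where f0: "Pi0 + (\<Sum>xs\<in>L. Prem xs) < real f0" using reals_Archimedean2 by blast
  define f where "f = max f0 M"
  obtain q where q: "q \<in> B" "measure_pmf.prob q {f<..} > 3/4 * \<theta>" using esc by blast
  define E where "E = {\<omega>. \<exists>k<K. f < \<omega> !! k \<and> (\<forall>j<k. \<omega> !! j \<le> M)}"
  have E: "E \<in> sets (iid q)" unfolding E_def by (rule snth_events_sets)
  have nonneg: "Prem xs \<ge> 0" for xs using scheme by (simp add: insurance_scheme_def)
  have sub: "{\<omega>. stake N \<omega> \<in> A \<and> sdrop N \<omega> \<in> E} \<subseteq> {\<omega>. goes_bankrupt Pi0 \<tau> Prem \<omega>}"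
  proof clarify
    fix \<omega> assume stA: "stake N \<omega> \<in> A" and "sdrop N \<omega> \<in> E"
    then obtain k where k: "k < K" "f < \<omega> !! (N + k)" "\<And>j. j < k \<Longrightarrow> \<omega> !! (N + j) \<le> M"
      by (auto simp: E_def sdrop_snth add.commute)
    have small: "\<omega> !! i \<le> M" if "i < N + k" for i
    proof (cases "i < N")
      case True
      then have "stake N \<omega> ! i \<in> set (stake N \<omega>)" by (intro nth_mem) simp
      then show ?thesis using bspec[OF A0 stA] True by (auto simp: stake_nth M_def)
    next
      case False
      then show ?thesis using k(3)[of "i - N"] that by simp
    qed
    have "stake i \<omega> \<in> L" if "i \<le> N + k" for i
      using small that k(1) by (force simp: L_def in_set_conv_nth stake_nth)
    then have img: "(\<lambda>i. stake i \<omega>) ` {..N + k} \<subseteq> L" by auto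
    \<comment> \<open>Prefixes of different lengths are different words, so the premiums over time
      form a partial sum over \<open>L\<close>.\<close>
    have "inj_on (\<lambda>i. stake i \<omega>) {..N + k}" by (rule inj_on_inverseI[where g = length]) simp
    then have "(\<Sum>i\<le>N + k. Prem (stake i \<omega>)) = (\<Sum>xs\<in>(\<lambda>i. stake i \<omega>) ` {..N + k}. Prem xs)"
      by (simp add: sum.reindex)
    also have "\<dots> \<le> (\<Sum>xs\<in>L. Prem xs)" using \<open>finite L\<close> img nonneg by (intro sum_mono2) auto
    finally have "Pi0 + (\<Sum>i\<le>N + k. Prem (stake i \<omega>)) < real (\<omega> !! (N + k))"
      using f0 k(2) unfolding f_def by linarith
    moreover have "\<tau> (stake (N + k) \<omega>)"
      using scheme_active_mono[OF scheme, of N \<omega> "N + k"] bspec[OF A0 stA] by simp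
    ultimately show "goes_bankrupt Pi0 \<tau> Prem \<omega>" by (intro bankrupt_by_huge_loss[OF scheme])
  qed
  let ?T = "measure_pmf.prob q {M<..}" and ?s = "measure_pmf.prob q {f<..}"
  have sT: "?s \<le> ?T" by (intro measure_pmf.finite_measure_mono) (auto simp: f_def)
  have "?T \<le> measure_pmf.prob q {M1<..}" by (intro measure_pmf.finite_measure_mono) (auto simp: M_def)
  with M1[OF q(1)] have T: "?T \<le> 3/2 * \<theta>" by linarith
  have T1: "?T \<le> 1" by (rule measure_pmf.prob_le_1)
  have "(1 - ?T) ^ K \<le> (1 - 3/4 * \<theta>) ^ K" using q(2) sT T1 by (intro power_mono) auto
  with K have "1/2 \<le> 1 - (1 - ?T) ^ K" by linarith
  \<comment> \<open>The unknown \<open>\<theta>\<close> cancels: the mass beyond \<open>f\<close> is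
    at least half of the bound on the mass beyond \<open>M\<close>.\<close>
  then have "3/4 * \<theta> * (1/2) \<le> ?s * (1 - (1 - ?T) ^ K)"
    using q(2) \<theta> by (intro mult_mono) auto
  also have "\<dots> = ?T * measure (iid q) E"
    unfolding E_def by (subst first_large_loss_prob) (auto simp: f_def)
  also have "\<dots> \<le> 3/2 * \<theta> * measure (iid q) E" using T by (intro mult_right_mono) auto
  finally have mE: "1/4 \<le> measure (iid q) E" using \<theta> by simp
  have "1/8 = 1/2 * (1/4 :: real)" by simp
  also have "\<dots> \<le> (\<Sum>xs\<in>A. prod_list (map (pmf q) xs)) * measure (iid q) E"
    using entry[OF q(1)] mE by (intro mult_mono) auto
  also have "\<dots> = measure (iid q) {\<omega>. stake N \<omega> \<in> A \<and> sdrop N \<omega> \<in> E}"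
    using measure_iid_prefix_in[OF E A(1)] A0 by simp
  also have "\<dots> \<le> measure (iid q) {\<omega>. goes_bankrupt Pi0 \<tau> Prem \<omega>}"
    using sub goes_bankrupt_sets
    by (intro finite_measure.finite_measure_mono prob_space.finite_measure prob_space_iid)
  finally show False using safe[of q] q(1) by (simp add: B_def)
qed

section \<open>Detecting a neighbourhood from empirical frequencies\<close>

text \<open>The moment generating function of a binomial count, by conditioning on the first
  loss.\<close>

lemma nn_integral_exp_count:
  assumes "s \<ge> 0"
  shows "(\<integral>\<^sup>+\<omega>. ennreal (exp (s * real (length (filter (\<lambda>x. x \<in> S) (stake n \<omega>))))) \<partial>iid q)
    = ennreal ((1 + (exp s - 1) * measure_pmf.prob q S) ^ n)"
proof (induction n)
  case 0
  show ?case using prob_space.emeasure_space_1[OF prob_space_iid[of q]] by simp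
next
  case (Suc n)
  let ?F = "\<lambda>n \<omega>. ennreal (exp (s * real (length (filter (\<lambda>x. x \<in> S) (stake n \<omega>)))))"
  have step: "?F (Suc n) (x ## \<omega>) = (1 + ennreal (exp s - 1) * indicator S x) * ?F n \<omega>" for x \<omega>
    using assms by (auto simp: ennreal_mult[symmetric] ennreal_plus[symmetric] exp_add[symmetric] distrib_left
      simp flip: ennreal_1 split: split_indicator)
  have "(\<integral>\<^sup>+\<omega>. ?F (Suc n) \<omega> \<partial>iid q) =
      (\<integral>\<^sup>+x. (\<integral>\<^sup>+\<omega>. ?F (Suc n) (x ## \<omega>) \<partial>iid q) \<partial>measure_pmf q)"
    by (rule nn_integral_iid[OF prefix_fun_measurable])
  also have "\<dots> = (\<integral>\<^sup>+x. (1 + ennreal (exp s - 1) * indicator S x) * (\<integral>\<^sup>+\<omega>. ?F n \<omega> \<partial>iid q) \<partial>measure_pmf q)"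
    unfolding step by (intro nn_integral_cong nn_integral_cmult prefix_fun_measurable)
  also have "\<dots> = (\<integral>\<^sup>+x. (1 + ennreal (exp s - 1) * indicator S x) \<partial>measure_pmf q) * (\<integral>\<^sup>+\<omega>. ?F n \<omega> \<partial>iid q)"
    by (rule nn_integral_multc) simp
  also have "(\<integral>\<^sup>+x. (1 + ennreal (exp s - 1) * indicator S x) \<partial>measure_pmf q)
      = 1 + ennreal (exp s - 1) * emeasure (measure_pmf q) S"
    by (subst nn_integral_add) (auto simp: nn_integral_cmult_indicator)
  also have "\<dots> = ennreal (1 + (exp s - 1) * measure_pmf.prob q S)"
    using assms by (simp add: measure_pmf.emeasure_eq_measure ennreal_mult[symmetric] ennreal_plus[symmetric]
      del: ennreal_plus flip: ennreal_1)
  finally show ?case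
    using assms by (simp only: Suc ennreal_mult[symmetric] power_Suc) (simp add: ennreal_mult)
qed

text \<open>A Chernoff bound with \<open>s = r / 2\<close>. The hypothesis \<open>r \<le> 2\<close>
  gives \<open>s \<le> 1\<close>, where \<open>exp s \<le> 1 + s + s\<^sup>2\<close>; the exponent
  per loss is then at most \<open>s\<^sup>2 - s * r\<close>.\<close>

lemma count_upper_tail:
  assumes "0 < r" "r \<le> 2"
  shows "measure (iid q) {\<omega>. real n * (measure_pmf.prob q S + r) \<le> real (length (filter (\<lambda>x. x \<in> S) (stake n \<omega>)))}
    \<le> exp (- (real n * r\<^sup>2 / 4))" (is "measure _ ?E \<le> _")
proof -
  interpret I: prob_space "iid q" by (rule prob_space_iid)
  define s where "s = r / 2"
  have s: "0 \<le> s" "s \<le> 1" using assms by (auto simp: s_def)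
  let ?\<sigma> = "measure_pmf.prob q S"
  let ?F = "\<lambda>\<omega>. ennreal (exp (s * real (length (filter (\<lambda>x. x \<in> S) (stake n \<omega>)))))"
  let ?c = "exp (- s * (real n * (?\<sigma> + r)))"
  have meas: "?F \<in> borel_measurable (iid q)" by (rule prefix_fun_measurable)
  have "?E \<subseteq> {\<omega>\<in>space (iid q). 1 \<le> ennreal ?c * ?F \<omega>}"
  proof
    fix \<omega> assume "\<omega> \<in> ?E"
    then have "s * (real n * (?\<sigma> + r)) \<le> s * real (length (filter (\<lambda>x. x \<in> S) (stake n \<omega>)))"
      using s by (intro mult_left_mono) auto
    then have "1 \<le> ennreal ?c * ?F \<omega>"
      by (simp add: ennreal_mult[symmetric] exp_add[symmetric])
    then show "\<omega> \<in> {\<omega>\<in>space (iid q). 1 \<le> ennreal ?c * ?F \<omega>}" by simp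
  qed
  then have "emeasure (iid q) ?E \<le> emeasure (iid q) {\<omega>\<in>space (iid q). 1 \<le> ennreal ?c * ?F \<omega>}"
    by (rule emeasure_mono) (use meas in measurable)
  also have "\<dots> \<le> ennreal ?c * (\<integral>\<^sup>+\<omega>. ?F \<omega> * indicator (space (iid q)) \<omega> \<partial>iid q)"
    by (intro nn_integral_Markov_inequality borel_measurable_times_ennreal meas
      borel_measurable_indicator sets.top)
  also have "\<dots> = ennreal (?c * (1 + (exp s - 1) * ?\<sigma>) ^ n)"
    using s by (simp add: nn_integral_exp_count ennreal_mult)
  finally have "measure (iid q) ?E \<le> ?c * (1 + (exp s - 1) * ?\<sigma>) ^ n"
    using s by (simp add: I.emeasure_eq_measure)
  also have "\<dots> \<le> ?c * exp ((exp s - 1) * ?\<sigma>) ^ n"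
    using s by (intro mult_left_mono power_mono exp_ge_add_one_self) auto
  also have "\<dots> \<le> ?c * exp ((s + s\<^sup>2) * ?\<sigma>) ^ n"
    using exp_bound[OF s] by (intro mult_left_mono power_mono) (auto intro!: mult_right_mono)
  also have "\<dots> = exp (real n * (s\<^sup>2 * ?\<sigma> - s * r))"
    by (simp add: exp_of_nat_mult[symmetric] exp_add[symmetric] algebra_simps)
  also have "\<dots> \<le> exp (real n * (s\<^sup>2 * 1 - s * r))"
    by (auto intro!: mult_left_mono mult_left_le)
  also have "\<dots> = exp (- (real n * r\<^sup>2 / 4))"
    by (simp add: s_def power2_eq_square field_simps)
  finally show ?thesis .
qed

definition freq :: "nat list \<Rightarrow> nat \<Rightarrow> real" where
  "freq xs y = real (length (filter (\<lambda>x. x = y) xs)) / real (length xs)"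

text \<open>A union bound over coordinates and signs: too few occurrences of \<open>y\<close> are
  too many of its complement, so the upper tail handles both.\<close>

lemma freq_deviation:
  assumes "0 < c" "c \<le> 1" "0 < n"
  shows "measure (iid q) {\<omega>. \<exists>y<m. \<bar>freq (stake n \<omega>) y - pmf q y\<bar> > c}
    \<le> 2 * real m * exp (- (real n * c\<^sup>2 / 4))"
proof -
  interpret I: prob_space "iid q" by (rule prob_space_iid)
  let ?E = "\<lambda>S. {\<omega>. real n * (measure_pmf.prob q S + c) \<le> real (length (filter (\<lambda>x. x \<in> S) (stake n \<omega>)))}"
  have meas: "?E S \<in> sets (iid q)" for S
    using prefix_event_sets[of "\<lambda>xs. real n * (measure_pmf.prob q S + c) \<le> real (length (filter (\<lambda>x. x \<in> S) xs))"] .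
  have "{\<omega>. \<exists>y<m. \<bar>freq (stake n \<omega>) y - pmf q y\<bar> > c} \<subseteq> (\<Union>y<m. ?E {y} \<union> ?E (- {y}))"
  proof
    fix \<omega> assume "\<omega> \<in> {\<omega>. \<exists>y<m. \<bar>freq (stake n \<omega>) y - pmf q y\<bar> > c}"
    then obtain y where y: "y < m" "\<bar>freq (stake n \<omega>) y - pmf q y\<bar> > c" by auto
    let ?L = "real (length (filter (\<lambda>x. x = y) (stake n \<omega>)))"
    have compl: "?L + real (length (filter (\<lambda>x. x \<noteq> y) (stake n \<omega>))) = real n"
      using sum_length_filter_compl[of "\<lambda>x. x = y" "stake n \<omega>"] by (metis length_stake of_nat_add)
    have pc: "measure_pmf.prob q (- {y}) = 1 - pmf q y"
      using measure_pmf.prob_compl[of "{y}" q] by (simp add: Compl_eq_Diff_UNIV measure_pmf_single)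
    from y(2) consider "?L / real n > pmf q y + c" | "?L / real n < pmf q y - c"
      by (auto simp: freq_def abs_if split: if_splits)
    then have "\<omega> \<in> ?E {y} \<union> ?E (- {y})"
    proof cases
      case 1
      then have "real n * (pmf q y + c) < ?L" using assms(3) by (simp add: field_simps)
      then show ?thesis by (simp add: measure_pmf_single)
    next
      case 2
      then have "?L < real n * (pmf q y - c)" using assms(3) by (simp add: field_simps)
      then have "real n * (measure_pmf.prob q (- {y}) + c) \<le> real (length (filter (\<lambda>x. x \<noteq> y) (stake n \<omega>)))"
        using compl unfolding pc by (simp add: algebra_simps)
      then show ?thesis by simp
    qed
    with y(1) show "\<omega> \<in> (\<Union>y<m. ?E {y} \<union> ?E (- {y}))" by blast
  qed
  moreover have "(\<Union>y<m. ?E {y} \<union> ?E (- {y})) \<in> sets (iid q)"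
    by (intro sets.finite_UN sets.Un meas) simp
  ultimately have "measure (iid q) {\<omega>. \<exists>y<m. \<bar>freq (stake n \<omega>) y - pmf q y\<bar> > c}
      \<le> measure (iid q) (\<Union>y<m. ?E {y} \<union> ?E (- {y}))"
    by (rule I.finite_measure_mono)
  also have "\<dots> \<le> (\<Sum>y<m. measure (iid q) (?E {y} \<union> ?E (- {y})))"
    by (rule I.finite_measure_subadditive_finite) (use sets.Un[OF meas meas] in blast)+
  also have "\<dots> \<le> (\<Sum>y<m. 2 * exp (- (real n * c\<^sup>2 / 4)))"
  proof (rule sum_mono)
    fix y
    have "measure (iid q) (?E {y} \<union> ?E (- {y})) \<le> measure (iid q) (?E {y}) + measure (iid q) (?E (- {y}))"
      by (rule measure_Un_le[OF meas meas])
    also have "\<dots> \<le> exp (- (real n * c\<^sup>2 / 4)) + exp (- (real n * c\<^sup>2 / 4))"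
      using assms by (intro add_mono count_upper_tail) auto
    finally show "measure (iid q) (?E {y} \<union> ?E (- {y})) \<le> 2 * exp (- (real n * c\<^sup>2 / 4))" by simp
  qed
  finally show ?thesis by simp
qed

text \<open>The sample size precedes \<open>q\<close>, since the exponential bound does not involve
  the law.\<close>

lemma uniform_weak_law:
  fixes m n0 :: nat
  assumes "0 < c" "c \<le> 1" "0 < \<theta>"
  shows "\<exists>n\<ge>n0. \<forall>q. measure (iid q) {\<omega>. \<exists>y<m. \<bar>freq (stake n \<omega>) y - pmf q y\<bar> > c} \<le> \<theta>"
proof -
  have "(\<lambda>n. 2 * real m * exp (- (c\<^sup>2 / 4)) ^ n) \<longlonglongrightarrow> 2 * real m * 0"
    using assms(1) by (intro tendsto_mult tendsto_const LIMSEQ_power_zero) auto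
  then have "\<forall>\<^sub>F n in sequentially. 2 * real m * exp (- (c\<^sup>2 / 4)) ^ n < \<theta>"
    using assms(3) by (intro order_tendstoD) auto
  then obtain N where N: "2 * real m * exp (- (c\<^sup>2 / 4)) ^ n < \<theta>" if "n \<ge> N" for n
    by (auto simp: eventually_sequentially)
  \<comment> \<open>The successor secures the positive sample size that
    \<open>freq_deviation\<close> demands.\<close>
  define n where "n = Suc (max N n0)"
  have "2 * real m * exp (- (real n * c\<^sup>2 / 4)) < \<theta>"
    using N[of n] unfolding exp_of_nat_mult[symmetric] by (simp add: n_def)
  moreover have "0 < n" "n0 \<le> n" by (auto simp: n_def)
  ultimately show ?thesis using freq_deviation[OF assms(1,2), of n] by (meson less_imp_le order_trans)
qed

text \<open>A code \<open>(cs, k)\<close> stands for the point with coordinates \<open>cs ! y / (k + 1)\<close>, \<open>y < length cs\<close>;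
  radii are multiples of \<open>1 / (k + 1)\<close>. Codes form a countable set, which replaces an appeal to
  separability of the space of distributions.\<close>

definition near :: "nat list \<times> nat \<Rightarrow> real \<Rightarrow> (nat \<Rightarrow> real) \<Rightarrow> bool" where
  "near u r v \<longleftrightarrow> (\<forall>y<length (fst u).
     \<bar>v y - real (fst u ! y) / real (Suc (snd u))\<bar> \<le> r / real (Suc (snd u)))"

text \<open>Laws within radius 1 should pass a test at radius 2, and passing laws should lie within
  radius 3. Either error forces a deviation of more than one unit.\<close>

lemma near_triangle:
  assumes "near u r v" "\<not> near u (r + 1) w"
  shows "\<exists>y<length (fst u). \<bar>v y - w y\<bar> > 1 / real (Suc (snd u))"
proof -
  obtain y where y: "y < length (fst u)"
    "\<bar>w y - real (fst u ! y) / real (Suc (snd u))\<bar> > (r + 1) / real (Suc (snd u))"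
    using assms(2) unfolding near_def by (auto simp: not_le)
  have "\<bar>v y - real (fst u ! y) / real (Suc (snd u))\<bar> \<le> r / real (Suc (snd u))"
    using assms(1) y(1) by (simp add: near_def)
  with y show ?thesis unfolding add_divide_distrib by (intro exI[of _ y]) linarith
qed

text \<open>Radius 3, because a test passed at radius 2 locates the true law only up to one further
  unit.\<close>

definition tight_code :: "nat pmf set \<Rightarrow> nat list \<times> nat \<Rightarrow> bool" where
  "tight_code P u \<longleftrightarrow> (\<forall>\<delta>>0. \<exists>g::nat. \<forall>q\<in>P. near u 3 (pmf q) \<longrightarrow> measure_pmf.prob q {g<..} \<le> \<delta>)"

text \<open>Finitely many coordinates decide membership in a tight ball around \<open>p\<close>;
  rounding them down to a fine grid gives the code.\<close>

lemma not_deceptive_imp_tight_code: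
  assumes "\<not> deceptive P p"
  shows "\<exists>u. near u 1 (pmf p) \<and> tight_code P u"
proof -
  obtain \<epsilon> where \<epsilon>: "\<epsilon> > 0"
    "\<And>\<delta>. \<delta> > 0 \<Longrightarrow> \<exists>g::nat. \<forall>q\<in>P. distJS p q < \<epsilon> \<longrightarrow> measure_pmf.prob q {g<..} \<le> \<delta>"
    using not_deceptive_imp_tight_ball[OF assms] by blast
  obtain m r where r: "r > 0" "\<And>q. (\<And>y. y < m \<Longrightarrow> \<bar>pmf p y - pmf q y\<bar> \<le> r) \<Longrightarrow> distJS p q < \<epsilon>"
    using distJS_small_if_close_on_prefix[OF \<epsilon>(1), of p] by blast
  \<comment> \<open>The law \<open>p\<close> at radius 1 and any \<open>q\<close> at radius 3 differ
    by at most four units of \<open>1 / real (Suc k)\<close>.\<close>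
  obtain k where k: "4 / r < real (Suc k)" using reals_Archimedean2 less_Suc_eq of_nat_less_iff less_trans by (metis lessI)
  let ?K = "real (Suc k)"
  define u where "u = (map (\<lambda>y. nat \<lfloor>pmf p y * ?K\<rfloor>) [0..<m], k)"
  have "near u 1 (pmf p)"
    unfolding near_def
  proof (intro allI impI)
    fix y assume "y < length (fst u)"
    then have y: "real (fst u ! y) = real_of_int \<lfloor>pmf p y * ?K\<rfloor>" by (simp add: u_def)
    have "pmf p y - real (fst u ! y) / ?K = (pmf p y * ?K - real (fst u ! y)) / ?K"
      by (simp add: diff_divide_distrib)
    moreover have "\<bar>pmf p y * ?K - real (fst u ! y)\<bar> \<le> 1"
      unfolding y by linarith
    ultimately have "\<bar>pmf p y - real (fst u ! y) / ?K\<bar> \<le> 1 / ?K"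
      by (simp add: divide_right_mono)
    then show "\<bar>pmf p y - real (fst u ! y) / real (Suc (snd u))\<bar> \<le> 1 / real (Suc (snd u))"
      by (simp add: u_def)
  qed
  moreover have "distJS p q < \<epsilon>" if q: "near u 3 (pmf q)" for q
  proof (rule r(2))
    fix y assume "y < m"
    then have "y < length (fst u)" by (simp add: u_def)
    then have "\<bar>pmf p y - real (fst u ! y) / ?K\<bar> \<le> 1 / ?K" "\<bar>pmf q y - real (fst u ! y) / ?K\<bar> \<le> 3 / ?K"
      using \<open>near u 1 (pmf p)\<close> q by (auto simp: near_def u_def)
    then have "\<bar>pmf p y - pmf q y\<bar> \<le> 1 / ?K + 3 / ?K" by linarith
    also have "\<dots> = 4 / ?K" by simp
    also have "\<dots> \<le> r" using k r(1) by (simp add: field_simps)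
    finally show "\<bar>pmf p y - pmf q y\<bar> \<le> r" .
  qed
  ultimately show ?thesis using \<epsilon>(2) unfolding tight_code_def by meson
qed

section \<open>Combining countably many tests and premiums\<close>

lemma not_bankrupt_if_losses_covered:
  assumes "Pi0 \<ge> 0" "\<And>i. \<tau> (stake i \<omega>) \<Longrightarrow> real (\<omega> !! i) \<le> Prem (stake i \<omega>)"
  shows "\<not> goes_bankrupt Pi0 \<tau> Prem \<omega>"
proof -
  have "0 \<le> (\<Sum>i<n. (Prem (stake i \<omega>) - real (\<omega> !! i)) * (if \<tau> (stake i \<omega>) then 1 else 0))" for n
    using assms(2) by (intro sum_nonneg) auto
  then show ?thesis using assms(1) unfolding goes_bankrupt_def by (meson add_nonneg_nonneg not_le)
qed

text \<open>The second component of the decoded pair is free, and the pair of \<open>i\<close> and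
  \<open>J\<close> has code at least \<open>J\<close>.\<close>

lemma recurrent_enumeration:
  assumes "countable G" "G \<noteq> {}"
  shows "\<exists>u :: nat \<Rightarrow> 'a. range u \<subseteq> G \<and> (\<forall>v\<in>G. \<forall>J. \<exists>j\<ge>J. u j = v)"
proof (intro exI[of _ "\<lambda>j. from_nat_into G (fst (prod_decode j))"] conjI ballI allI)
  show "range (\<lambda>j. from_nat_into G (fst (prod_decode j))) \<subseteq> G"
    using from_nat_into[OF assms(2)] by blast
  fix v J assume "v \<in> G"
  then obtain i where "from_nat_into G i = v" using from_nat_into_surj[OF assms(1)] by blast
  then show "\<exists>j\<ge>J. from_nat_into G (fst (prod_decode j)) = v"
    by (intro exI[of _ "prod_encode (i, J)"]) (simp add: le_prod_encode_2)
qed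

lemma halving_sums: "(\<lambda>j. \<eta> / 2 ^ (j + c)) sums (\<eta> * 2 / 2 ^ c)" for \<eta> :: real
proof -
  have "(\<lambda>j. \<eta> / 2 ^ c * (1 / 2) ^ j) sums (\<eta> / 2 ^ c * (1 / (1 - 1 / 2)))"
    by (intro sums_mult geometric_sums) auto
  then show ?thesis by (simp add: power_add power_divide mult.commute)
qed

section \<open>Insuring a class without deceptive distributions\<close>

lemma no_deceptive_imp_insurable:
  assumes "Pi0 \<ge> 0" and nondec: "\<And>p. p \<in> P \<Longrightarrow> \<not> deceptive P p"
  shows "insurable P Pi0"
proof (cases "P = {}")
  case True
  \<comment> \<open>The enumeration of codes requires a nonempty set. With no law to insure, never
    entering is a scheme vacuously.\<close>
  then have "insurance_scheme P (\<lambda>_. False) (\<lambda>_. 0)" by (simp add: insurance_scheme_def)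
  with True show ?thesis unfolding insurable_def by blast
next
  case False
  define G where "G = {u. tight_code P u}"
  have "G \<noteq> {}" using False not_deceptive_imp_tight_code nondec unfolding G_def by blast
  then obtain u :: "nat \<Rightarrow> nat list \<times> nat" where u: "range u \<subseteq> G" "\<forall>v\<in>G. \<forall>J. \<exists>j\<ge>J. u j = v"
    using recurrent_enumeration[of G] by auto
  have uG: "tight_code P (u j)" for j using u(1) by (auto simp: G_def)
  have recur: "\<exists>j\<ge>J. u j = v" if "tight_code P v" for v J using u(2) that unfolding G_def by blast
  show ?thesis unfolding insurable_def
  proof (intro allI impI)
    fix \<eta> :: real assume \<eta>: "\<eta> > 0"
    let ?m = "\<lambda>j. length (fst (u j))" and ?c = "\<lambda>j. 1 / real (Suc (snd (u j)))"
    define V where "V = (\<lambda>q j n. {\<omega>. \<exists>y<?m j. \<bar>freq (stake n \<omega>) y - pmf q y\<bar> > ?c j})"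
    \<comment> \<open>The requirement \<open>n \<ge> j\<close> ensures that by time \<open>t\<close>
      only tests with index at most \<open>t\<close> have been made.\<close>
    have "\<exists>n\<ge>j. \<forall>q. measure (iid q) (V q j n) \<le> \<eta> / 2 ^ (j + 2)" for j
      unfolding V_def by (rule uniform_weak_law) (use \<eta> in auto)
    then obtain n where n: "\<And>j. j \<le> n j" "\<And>j q. measure (iid q) (V q j (n j)) \<le> \<eta> / 2 ^ (j + 2)"
      by metis
    \<comment> \<open>Wrong tests cost at most \<open>\<eta> / 2\<close> in all and uncovered losses
      at most \<open>\<eta> / 4\<close>.\<close>
    define \<delta> where "\<delta> = (\<lambda>t. \<eta> / 2 ^ (t + 3))"
    have \<delta>pos: "\<delta> t > 0" for t using \<eta> by (simp add: \<delta>_def)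
    have "\<exists>g::nat. \<forall>q\<in>P. near (u j) 3 (pmf q) \<longrightarrow> measure_pmf.prob q {g<..} \<le> \<delta> t" for j t
      using uG[of j] \<delta>pos[of t] unfolding tight_code_def by blast
    then obtain g :: "nat \<Rightarrow> nat \<Rightarrow> nat" where
      g: "\<And>j t q. q \<in> P \<Longrightarrow> near (u j) 3 (pmf q) \<Longrightarrow> measure_pmf.prob q {g j t<..} \<le> \<delta> t"
      by metis
    define pass where "pass = (\<lambda>j xs. near (u j) 2 (freq xs))"
    define \<tau> where "\<tau> = (\<lambda>xs. \<exists>j. n j \<le> length xs \<and> pass j (take (n j) xs))"
    \<comment> \<open>The sum dominates each \<open>g j t\<close> with \<open>j \<le> t\<close>, so
      the premium need not know which test was passed.\<close>
    define c where "c = (\<lambda>t. \<Sum>j\<le>t. g j t)"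
    define Prem where "Prem = (\<lambda>xs. if \<tau> xs then real (c (length xs)) else 0)"
    have Vs: "V q j k \<in> sets (iid q)" for q j k
      unfolding V_def using prefix_event_sets[of "\<lambda>xs. \<exists>y<?m j. \<bar>freq xs y - pmf q y\<bar> > ?c j" k q] .
    have false_pass: "\<omega> \<in> V q j (n j)" if "pass j (stake (n j) \<omega>)" "\<not> near (u j) 3 (pmf q)" for \<omega> q j
      using near_triangle[of "u j" 2 "freq (stake (n j) \<omega>)" "pmf q"] that by (simp add: V_def pass_def)
    have missed: "\<omega> \<in> V q j (n j)" if "\<not> pass j (stake (n j) \<omega>)" "near (u j) 1 (pmf q)" for \<omega> q j
      using near_triangle[of "u j" 1 "pmf q" "freq (stake (n j) \<omega>)"] that
      by (simp add: V_def pass_def abs_minus_commute)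
    have \<tau>_stake: "\<tau> (stake i \<omega>) \<longleftrightarrow> (\<exists>j. n j \<le> i \<and> pass j (stake (n j) \<omega>))" for i \<omega>
      by (auto simp: \<tau>_def take_stake min_def)
    have entry: "measure (iid p) {\<omega>. \<exists>i. \<tau> (stake i \<omega>)} = 1" if p: "p \<in> P" for p
    proof -
      interpret I: prob_space "iid p" by (rule prob_space_iid)
      let ?E = "{\<omega>. \<exists>i. \<tau> (stake i \<omega>)}"
      have Es: "?E \<in> sets (iid p)" using prefix_events_sets[of "\<lambda>_. \<tau>"] .
      obtain v where v: "near v 1 (pmf p)" "tight_code P v"
        using not_deceptive_imp_tight_code nondec[OF p] by blast
      \<comment> \<open>A tight code near \<open>p\<close> is tested at arbitrarily late indices.
        Never entering means missing all these tests, whose error probabilities tend to 0.\<close>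
      have bound: "measure (iid p) (- ?E) \<le> \<eta> * (1/2) ^ J" for J
      proof -
        obtain j where j: "j \<ge> J" "u j = v" using recur[OF v(2)] by blast
        have "- ?E \<subseteq> V p j (n j)"
        proof
          fix \<omega> assume "\<omega> \<in> - ?E"
          then have "\<not> pass j (stake (n j) \<omega>)" using \<tau>_stake by blast
          then show "\<omega> \<in> V p j (n j)" using missed v(1) j(2) by blast
        qed
        then have "measure (iid p) (- ?E) \<le> \<eta> / 2 ^ (j + 2)"
          using I.finite_measure_mono[OF _ Vs] n(2) order_trans by blast
        also have "\<dots> \<le> \<eta> / 2 ^ J" using \<eta> j(1) by (intro divide_left_mono power_increasing) auto
        finally show ?thesis by (simp add: power_divide)
      qed
      have "(\<lambda>J. \<eta> * (1/2) ^ J) \<longlonglongrightarrow> \<eta> * 0" by (intro tendsto_mult tendsto_const LIMSEQ_power_zero) auto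
      from LIMSEQ_le_const[OF this, of "measure (iid p) (- ?E)"] bound
      have "measure (iid p) (- ?E) \<le> 0" by simp
      then show ?thesis using I.prob_compl[OF Es]
        by (intro antisym I.prob_le_1) (simp add: Compl_eq_Diff_UNIV)
    qed
    have "insurance_scheme P \<tau> Prem" unfolding insurance_scheme_def
    proof (intro conjI allI ballI impI entry)
      fix xs x assume "\<tau> xs"
      then obtain j where "n j \<le> length xs" "pass j (take (n j) xs)" by (auto simp: \<tau>_def)
      then show "\<tau> (xs @ [x])" unfolding \<tau>_def by (intro exI[of _ j]) simp
    qed (auto simp: Prem_def)
    moreover have "measure (iid q) {\<omega>. goes_bankrupt Pi0 \<tau> Prem \<omega>} < \<eta>" if q: "q \<in> P" for q
    proof -
      interpret I: prob_space "iid q" by (rule prob_space_iid)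
      \<comment> \<open>Nearness to a code is a property of \<open>q\<close> alone. Where it fails,
        no tail bound is available, and only a false pass could cause entry.\<close>
      define W where "W = (\<lambda>t. if \<exists>j\<le>t. near (u j) 3 (pmf q) then {\<omega>. \<omega> !! t \<in> {c t<..}} else {})"
      have Ws: "W t \<in> sets (iid q)" for t
        unfolding W_def using snth_event_sets[of "\<lambda>x. x \<in> {c t<..}" t q] by simp
      have Wm: "measure (iid q) (W t) \<le> \<eta> / 2 ^ (t + 3)" for t
      proof (cases "\<exists>j\<le>t. near (u j) 3 (pmf q)")
        case True
        then obtain j where j: "j \<le> t" "near (u j) 3 (pmf q)" by blast
        have "g j t \<le> c t" unfolding c_def using j(1) by (intro member_le_sum) auto
        then have "measure_pmf.prob q {c t<..} \<le> measure_pmf.prob q {g j t<..}"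
          by (intro measure_pmf.finite_measure_mono) auto
        also have "\<dots> \<le> \<delta> t" by (rule g[OF q j(2)])
        finally show ?thesis using True measure_iid_snth[of q t "{c t<..}"] by (simp add: W_def \<delta>_def)
      qed (use \<eta> in \<open>auto simp: W_def\<close>)
      have sub: "{\<omega>. goes_bankrupt Pi0 \<tau> Prem \<omega>} \<subseteq> (\<Union>j. V q j (n j)) \<union> (\<Union>t. W t)"
      proof (rule ccontr)
        assume "\<not> ?thesis"
        then obtain \<omega> where bankrupt: "goes_bankrupt Pi0 \<tau> Prem \<omega>"
          and notV: "\<And>j. \<omega> \<notin> V q j (n j)" and notW: "\<And>t. \<omega> \<notin> W t" by blast
        \<comment> \<open>With no false pass, the test behind the entry is near \<open>q\<close> and
          has index at most \<open>i\<close>, so the premium covers the loss outside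
          \<open>W i\<close>.\<close>
        have "real (\<omega> !! i) \<le> Prem (stake i \<omega>)" if active: "\<tau> (stake i \<omega>)" for i
        proof -
          obtain j where j: "n j \<le> i" "pass j (stake (n j) \<omega>)" using active \<tau>_stake by blast
          have "near (u j) 3 (pmf q)" using false_pass[OF j(2)] notV by blast
          moreover have "j \<le> i" using n(1)[of j] j(1) by linarith
          ultimately have "\<exists>j\<le>i. near (u j) 3 (pmf q)" by blast
          then have "W i = {\<omega>. \<omega> !! i \<in> {c i<..}}" unfolding W_def by (rule if_P)
          then have "\<omega> !! i \<le> c i" using notW[of i] by simp
          then show ?thesis using active by (simp add: Prem_def)
        qed
        from not_bankrupt_if_losses_covered[OF assms(1), of \<tau> \<omega> Prem, OF this] bankrupt
        show False by blast
      qed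
      note sV = halving_sums[of \<eta> 2] and sW = halving_sums[of \<eta> 3]
      have sumV: "summable (\<lambda>j. measure (iid q) (V q j (n j)))"
        by (rule summable_comparison_test[OF _ sums_summable[OF sV]]) (use n(2) in auto)
      have sumW: "summable (\<lambda>t. measure (iid q) (W t))"
        by (rule summable_comparison_test[OF _ sums_summable[OF sW]]) (use Wm in auto)
      have "measure (iid q) {\<omega>. goes_bankrupt Pi0 \<tau> Prem \<omega>}
          \<le> measure (iid q) ((\<Union>j. V q j (n j)) \<union> (\<Union>t. W t))"
        using Vs Ws by (intro I.finite_measure_mono[OF sub] sets.Un sets.countable_UN) auto
      also have "\<dots> \<le> measure (iid q) (\<Union>j. V q j (n j)) + measure (iid q) (\<Union>t. W t)"
        using Vs Ws by (intro measure_Un_le sets.countable_UN) auto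
      also have "\<dots> \<le> (\<Sum>j. measure (iid q) (V q j (n j))) + (\<Sum>t. measure (iid q) (W t))"
        using Vs Ws sumV sumW by (intro add_mono I.finite_measure_subadditive_countably) auto
      also have "\<dots> \<le> (\<Sum>j. \<eta> / 2 ^ (j + 2)) + (\<Sum>t. \<eta> / 2 ^ (t + 3))"
        using n(2) Wm sumV sumW sums_summable[OF sV] sums_summable[OF sW] by (intro add_mono suminf_le) auto
      also have "\<dots> = \<eta> * 3 / 4" using sums_unique[OF sV] sums_unique[OF sW] by simp
      finally show ?thesis using \<eta> by simp
    qed
    ultimately show "\<exists>\<tau> Prem. insurance_scheme P \<tau> Prem \<and>
        (\<forall>p\<in>P. measure (iid p) {\<omega>. goes_bankrupt Pi0 \<tau> Prem \<omega>} < \<eta>)" by blast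
  qed
qed

theorem theorem1:
  fixes P :: "nat pmf set" and Pi0 :: real
  assumes "Pi0 \<ge> 0"
  shows "insurable P Pi0 \<longleftrightarrow> (\<forall>p\<in>P. \<not> deceptive P p)"
  using no_deceptive_imp_insurable[OF assms] deceptive_imp_not_insurable by blast

end
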